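(* For $\mathbf k=(k_1,\dots,k_d)\in\mathbb Z_{\ge0}^d$, \begin{align*} \Delta_a(v_{k_1}\cdots v_{k_d})=\sum_{\substack{0\le n\le d\\0\le i_1<j_1\le i_2<j_2\le\cdots\le i_n<j_n\le d}}\ \sum_{\mathbf l_1,\dots,\mathbf l_n}\ \prod_{s=1}^n\mathrm m_{\widehat{\mathbf k_s}^{j_s}+\mathbf l_s,\widehat{\mathbf k_s}^{j_s}}\ \Big(&v_{k_1}\cdots v_{k_{i_1}}⧢\mathop{⧢}_{s=1}^n\big(S(v_{k_{i_s+1}+l_{i_s+1}}\cdots v_{k_{j_s-1}+l_{j_s-1}})⧢v_{k_{j_s+1}+l_{j_s+1}}\cdots v_{k_{i_{s+1}}+l_{i_{s+1}}}\big)\Big)\\ &\otimes v_{k_{j_1}-|\mathbf l_1|}\cdots v_{k_{j_n}-|\mathbf l_n|}, \end{align*} where $i_{n+1}=d$, $\mathbf k_s=(k_{i_s+1},\dots,k_{i_{s+1}})$, $\widehat{\mathbf k_s}^{j_s}$ is $\mathbf k_s$ with the entry $k_{j_s}$ removed, and $\mathbf l_s=(l_{i_s+1},\dots,\widehat{l_{j_s}},\dots,l_{i_{s+1}})\in\mathbb Z_{\ge0}^{i_{s+1}-i_s-1}$ runs over tuples with $\mathbf l_s=\emptyset$ or $|\mathbf l_s|\le k_{j_s}-1$.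
   Context: $V=\{v_0,v_1,\dots\}$ with weight $\mathrm{wt}(v_0)=1$, $\mathrm{wt}(v_i)=i$. Ari multiplicity $\mathrm m_{\mathbf k,\mathbf l}=(-1)^{|\mathbf k|+|\mathbf l|}\prod_i\binom{k_i-1}{l_i-1}$ ($|\cdot|$ = sum of entries) with $\binom{-1}{-1}=1$, $\binom{k-1}{-1}=\binom{-1}{l-1}=0$ for $k,l>0$, usual binomials otherwise, $\mathrm m_{\emptyset,\emptyset}=1$. $\mathbb Q\langle V\rangle$: free associative algebra $=U(\mathrm{Lie}(V))$, shuffle coproduct $\Delta$ (letters primitive, Sweedler notation), antipode $S(a_1\cdots a_n)=(-1)^na_n\cdots a_1$, shuffle product $⧢$; empty products are $\mathbf1$. $\triangleright_a$ is the post-Lie product on the free Lie algebra $\mathrm{Lie}(V)$ obtained from the free magma $M(V)$ (product $\star$): for a bracketing $t(\mathbf k)$ of letters $v_{k_1},\dots,v_{k_r}$, $t(\mathbf k)\triangleright_av_0=0$ and $t(\mathbf k)\triangleright_av_s=\sum_{\mathbf l}\mathrm m_{\mathbf k,\mathbf l}v_{s+|\mathbf k|-|\mathbf l|}\star t(\mathbf l)$ for $s\ge1$ ($t(\mathbf l)$ the same bracketing of $v_{l_1},\dots,v_{l_r}$), extended linearly in $t$, as a derivation in the second argument, and descended via $a\star b\mapsto[a,b]$. It extends to $\mathbb Q\langle V\rangle^{\otimes2}$ by $x\triangleright\mathbf1=0$, $\mathbf1\triangleright A=A$, $xA\triangleright y=x\triangleright(A\triangleright y)-(x\triangleright A)\triangleright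 y$, $A\triangleright BC=(A_{(1)}\triangleright B)(A_{(2)}\triangleright C)$; the Grossman–Larson product is $A\circledast_aB=A_{(1)}(A_{(2)}\triangleright_aB)$, and $\Delta_a$ is defined by $(A\circledast_aB\mid C)=(A\otimes B\mid\Delta_a(C))$ for the pairing making words orthonormal. *)

theory Defs
  imports Complex_Main "HOL-Library.Poly_Mapping" "HOL-Library.Product_Plus"
begin

text \<open>The letter v_i is represented by the natural number i.  Words form the free monoid on the
  letters, written additively, so that the convolution product of \<^typ>\<open>'a \<Rightarrow>\<^sub>0 rat\<close> provided
  by the library is the concatenation product of Q<V>.  In the same way finitely supported
  functions on pairs of words are the tensor square of Q<V>, with the componentwise product.\<close>

datatype word = Word "nat list"

instantiation word :: monoid_add
begin

definition zero_word :: word where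
  "0 = Word []"

fun plus_word :: "word \<Rightarrow> word \<Rightarrow> word" where
  "Word u + Word w = Word (u @ w)"

instance
proof
  fix a b c :: word
  show "a + b + c = a + (b + c)" by (cases a; cases b; cases c) simp
  show "0 + a = a" by (cases a) (simp add: zero_word_def)
  show "a + 0 = a" by (cases a) (simp add: zero_word_def)
qed

end

type_synonym QV = "word \<Rightarrow>\<^sub>0 rat"
type_synonym QV2 = "(word \<times> word) \<Rightarrow>\<^sub>0 rat"

subsection \<open>Linear algebra on spaces with a basis\<close>

definition scale :: "rat \<Rightarrow> ('a \<Rightarrow>\<^sub>0 rat) \<Rightarrow> ('a \<Rightarrow>\<^sub>0 rat)" where
  "scale c p = Poly_Mapping.map ((*) c) p"

lemma lookup_scale: "Poly_Mapping.lookup (scale c p) k = c * Poly_Mapping.lookup p k"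
  by (simp add: scale_def Poly_Mapping.map.rep_eq when_def)

lemma vector_space_scale: "vector_space (scale :: rat \<Rightarrow> ('a \<Rightarrow>\<^sub>0 rat) \<Rightarrow> ('a \<Rightarrow>\<^sub>0 rat))"
  by unfold_locales (auto intro!: poly_mapping_eqI simp: lookup_scale lookup_add algebra_simps)

definition lin_ext :: "('a \<Rightarrow> ('b \<Rightarrow>\<^sub>0 rat)) \<Rightarrow> ('a \<Rightarrow>\<^sub>0 rat) \<Rightarrow> ('b \<Rightarrow>\<^sub>0 rat)" where
  "lin_ext f p = (\<Sum>a\<in>Poly_Mapping.keys p. scale (Poly_Mapping.lookup p a) (f a))"

definition bilin_ext ::
    "('a \<Rightarrow> 'b \<Rightarrow> ('c \<Rightarrow>\<^sub>0 rat)) \<Rightarrow> ('a \<Rightarrow>\<^sub>0 rat) \<Rightarrow> ('b \<Rightarrow>\<^sub>0 rat) \<Rightarrow> ('c \<Rightarrow>\<^sub>0 rat)" where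
  "bilin_ext f p q = lin_ext (\<lambda>a. lin_ext (f a) q) p"

definition is_bilinear ::
    "(('a \<Rightarrow>\<^sub>0 rat) \<Rightarrow> ('b \<Rightarrow>\<^sub>0 rat) \<Rightarrow> ('c \<Rightarrow>\<^sub>0 rat)) \<Rightarrow> bool" where
  "is_bilinear T \<longleftrightarrow> (\<forall>p. Vector_Spaces.linear scale scale (\<lambda>q. T p q)) \<and>
                     (\<forall>q. Vector_Spaces.linear scale scale (\<lambda>p. T p q))"

definition pairing :: "('a \<Rightarrow>\<^sub>0 rat) \<Rightarrow> ('a \<Rightarrow>\<^sub>0 rat) \<Rightarrow> rat" where
  "pairing p q = (\<Sum>a\<in>Poly_Mapping.keys p. Poly_Mapping.lookup p a * Poly_Mapping.lookup q a)"

definition tensor :: "QV \<Rightarrow> QV \<Rightarrow> QV2" where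
  "tensor = bilin_ext (\<lambda>u w. Poly_Mapping.single (u, w) 1)"

subsection \<open>The shuffle Hopf structure on Q<V>\<close>

definition vword :: "nat list \<Rightarrow> QV" where
  "vword w = Poly_Mapping.single (Word w) 1"

abbreviation letter :: "nat \<Rightarrow> QV" where
  "letter i \<equiv> vword [i]"

fun shuffle_list :: "nat list \<Rightarrow> nat list \<Rightarrow> QV" where
  "shuffle_list [] w = vword w"
| "shuffle_list u [] = vword u"
| "shuffle_list (a # u) (b # w) =
     letter a * shuffle_list u (b # w) + letter b * shuffle_list (a # u) w"

fun shuffle_word :: "word \<Rightarrow> word \<Rightarrow> QV" where
  "shuffle_word (Word u) (Word w) = shuffle_list u w"

definition shuffle :: "QV \<Rightarrow> QV \<Rightarrow> QV" where
  "shuffle = bilin_ext shuffle_word"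

fun antipode_word :: "word \<Rightarrow> QV" where
  "antipode_word (Word w) = scale ((- 1) ^ length w) (vword (rev w))"

definition antipode :: "QV \<Rightarrow> QV" where
  "antipode = lin_ext antipode_word"

text \<open>The algebra morphism from Q<V> to its tensor square for which all letters are primitive.\<close>

fun coprod_word :: "word \<Rightarrow> QV2" where
  "coprod_word (Word w) = prod_list (map (\<lambda>i. tensor (letter i) 1 + tensor 1 (letter i)) w)"

definition coprod :: "QV \<Rightarrow> QV2" where
  "coprod = lin_ext coprod_word"

text \<open>For bilinear f, the term \<open>sweedler f A\<close> is f(A_(1), A_(2)) in Sweedler notation.\<close>

definition sweedler :: "(QV \<Rightarrow> QV \<Rightarrow> QV) \<Rightarrow> QV \<Rightarrow> QV" where
  "sweedler f A = lin_ext (\<lambda>(u, w). f (Poly_Mapping.single u 1) (Poly_Mapping.single w 1)) (coprod A)"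

subsection \<open>The ari multiplicity\<close>

text \<open>With the convention that the binomial of k - 1 over l - 1 is 1 for k = l = 0 and 0 if
  exactly one of k, l is 0.\<close>

definition pred_binom :: "nat \<Rightarrow> nat \<Rightarrow> nat" where
  "pred_binom k l =
     (if k = 0 \<and> l = 0 then 1 else if k = 0 \<or> l = 0 then 0 else (k - 1) choose (l - 1))"

text \<open>Only used for lists of the same length.\<close>

definition ari_mult :: "nat list \<Rightarrow> nat list \<Rightarrow> rat" where
  "ari_mult ks ls = (- 1) ^ (sum_list ks + sum_list ls) *
     (\<Prod>i<length ks. of_nat (pred_binom (ks ! i) (ls ! i)))"

subsection \<open>The post-Lie product\<close>

datatype magma = Gen nat | Star magma magma

type_synonym QM = "magma \<Rightarrow>\<^sub>0 rat"

fun leaves :: "magma \<Rightarrow> nat list" where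
  "leaves (Gen i) = [i]"
| "leaves (Star a b) = leaves a @ leaves b"

text \<open>If t is the bracketing t(k), then \<open>relabel t ls\<close> is the same bracketing t(l) of the
  letters indexed by ls, a list with as many entries as t has leaves.\<close>

fun relabel :: "magma \<Rightarrow> nat list \<Rightarrow> magma" where
  "relabel (Gen i) ls = Gen (hd ls)"
| "relabel (Star a b) ls =
     Star (relabel a (take (length (leaves a)) ls)) (relabel b (drop (length (leaves a)) ls))"

definition star :: "QM \<Rightarrow> QM \<Rightarrow> QM" where
  "star = bilin_ext (\<lambda>a b. Poly_Mapping.single (Star a b) 1)"

text \<open>In the second equation the multiplicity vanishes unless each entry of ls is at most the
  corresponding entry of the list of leaves; so the sum is over all ls with non-zero multiplicity,
  and the subtraction on natural numbers is exact.\<close>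

fun magma_tri_basis :: "magma \<Rightarrow> magma \<Rightarrow> QM" where
  "magma_tri_basis t (Gen s) =
     (if s = 0 then 0
      else \<Sum>ls\<in>{ls. list_all2 (\<le>) ls (leaves t)}.
             scale (ari_mult (leaves t) ls)
               (Poly_Mapping.single
                  (Star (Gen (s + sum_list (leaves t) - sum_list ls)) (relabel t ls)) 1))"
| "magma_tri_basis t (Star a b) =
     star (magma_tri_basis t a) (Poly_Mapping.single b 1) +
     star (Poly_Mapping.single a 1) (magma_tri_basis t b)"

definition magma_tri :: "QM \<Rightarrow> QM \<Rightarrow> QM" where
  "magma_tri = bilin_ext magma_tri_basis"

text \<open>The free Lie algebra Lie(V) is realised inside its enveloping algebra Q<V>, as the image of
  the magma algebra under the map sending the magma product to the commutator.\<close>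

fun lie_proj_basis :: "magma \<Rightarrow> QV" where
  "lie_proj_basis (Gen i) = letter i"
| "lie_proj_basis (Star a b) =
     lie_proj_basis a * lie_proj_basis b - lie_proj_basis b * lie_proj_basis a"

definition lie_proj :: "QM \<Rightarrow> QV" where
  "lie_proj = lin_ext lie_proj_basis"

definition Lie :: "QV set" where
  "Lie = lie_proj ` UNIV"

text \<open>The second conjunct says that on Lie(V) the product T is the one to which
  \<^const>\<open>magma_tri\<close> descends; the remaining ones are the rules extending it to Q<V>.\<close>

definition is_post_lie_ext :: "(QV \<Rightarrow> QV \<Rightarrow> QV) \<Rightarrow> bool" where
  "is_post_lie_ext T \<longleftrightarrow>
     is_bilinear T \<and>
     (\<forall>x y. T (lie_proj x) (lie_proj y) = lie_proj (magma_tri x y)) \<and>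
     (\<forall>x\<in>Lie. T x 1 = 0) \<and>
     (\<forall>A. T 1 A = A) \<and>
     (\<forall>x\<in>Lie. \<forall>A. \<forall>y\<in>Lie. T (x * A) y = T x (T A y) - T (T x A) y) \<and>
     (\<forall>A B C. T A (B * C) = sweedler (\<lambda>A1 A2. T A1 B * T A2 C) A)"

definition tri_a :: "QV \<Rightarrow> QV \<Rightarrow> QV" where
  "tri_a = (THE T. is_post_lie_ext T)"

definition gl_prod :: "QV \<Rightarrow> QV \<Rightarrow> QV" where
  "gl_prod A B = sweedler (\<lambda>A1 A2. A1 * tri_a A2 B) A"

definition Delta_a :: "QV \<Rightarrow> QV2" where
  "Delta_a C = (THE D. \<forall>A B. pairing (gl_prod A B) C = pairing (tensor A B) D)"

subsection \<open>Index sets of the coproduct formula\<close>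

text \<open>\<open>slice ks a b\<close> is (k_{a+1}, ..., k_b), in the 1-based indexing of the formula.\<close>

definition slice :: "nat list \<Rightarrow> nat \<Rightarrow> nat \<Rightarrow> nat list" where
  "slice ks a b = take (b - a) (drop a ks)"

text \<open>Pairs of lists (i_1, ..., i_n), (j_1, ..., j_n) with
  i_1 < j_1 \<le> i_2 < j_2 \<le> ... \<le> i_n < j_n \<le> d.  The list \<open>I @ [d]\<close> incorporates the convention
  i_{n+1} = d; its entry with (0-based) index s is i_{s+1}.\<close>

definition cuts :: "nat \<Rightarrow> nat \<Rightarrow> (nat list \<times> nat list) set" where
  "cuts d n = {(I, J). length I = n \<and> length J = n \<and>
     (\<forall>s<n. I ! s < J ! s \<and> J ! s \<le> (I @ [d]) ! Suc s)}"

text \<open>\<open>khat ks i j i'\<close> is the tuple (k_{i+1}, ..., k_{i'}) with the entry k_j removed.\<close>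

definition khat :: "nat list \<Rightarrow> nat \<Rightarrow> nat \<Rightarrow> nat \<Rightarrow> nat list" where
  "khat ks i j i' = slice ks i (j - 1) @ slice ks j i'"

text \<open>The admissible tuples (l_1, ..., l_n) of tuples.  The bound is taken in the integers,
  since k_{j_s} may be 0.\<close>

definition shifts :: "nat list \<Rightarrow> nat list \<Rightarrow> nat list \<Rightarrow> nat list list set" where
  "shifts ks I J = {ls. length ls = length I \<and>
     (\<forall>s<length I.
        length (ls ! s) = (I @ [length ks]) ! Suc s - I ! s - 1 \<and>
        (ls ! s = [] \<or> int (sum_list (ls ! s)) \<le> int (ks ! (J ! s - 1)) - 1))}"

text \<open>S(v_{k_{i+1}+l_{i+1}} ... v_{k_{j-1}+l_{j-1}}) shuffled with
  v_{k_{j+1}+l_{j+1}} ... v_{k_{i'}+l_{i'}}.  The first j - i - 1 entries of l belong to the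
  positions before j, the remaining ones to the positions after j.\<close>

definition block :: "nat list \<Rightarrow> nat \<Rightarrow> nat \<Rightarrow> nat \<Rightarrow> nat list \<Rightarrow> QV" where
  "block ks i j i' l =
     shuffle (antipode (vword (map2 (+) (slice ks i (j - 1)) (take (j - i - 1) l))))
             (vword (map2 (+) (slice ks j i') (drop (j - i - 1) l)))"

end

theory Submission
  imports Defs
begin

text \<open>The product is constructed explicitly and then shown to be the only one satisfying the axioms.  On a
  letter v_s with s > 0, a word A acts by the right adjoint action, \<open>S(A_(1)) v_(s+n) A_(2)\<close>, after
  the letters of A have been shifted down by n in total with the ari coefficients; on words it is
  extended by the Sweedler rule.  Shifting v_k to v_l with coefficient \<open>ari k l\<close> corresponds to
  passing from \<open>X^(k-1)\<close> to \<open>(X - 1)^(k-1)\<close>, and the resulting binomial identity says that shifts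
  commute with the action; for Lie elements x this gives the rule for x A.  For
  uniqueness, \<open>T x\<close> preserves the number of Lie factors of A, while x A has one more.

  Concatenation is dual to deconcatenation and the unshuffling of A is dual to the shuffle product.
  So the coefficient of \<open>v_k1 ... v_kd\<close> in \<open>A_(1) (A_(2) \<triangleright> v_s1 ... v_sn)\<close> is a sum over factorisations of
  the word into an initial piece and n blocks; in each block one letter comes from the corresponding
  letter of \<open>v_s1 ... v_sn\<close>, with an antipode before it and a plain word after it.\<close>

subsection \<open>Linear maps between spaces with a basis\<close>

text \<open>The binomials come from a change of variables. With v_s written as X^(s-1), bracketing
  by v_a with the shifts of \<open>step\<close> becomes X^(s-1) (Y - X)^(a-1): the variable of the
  acting letter is measured relative to that of the letter acted on. In these terms
  \<open>ari_shift\<close> says that a difference is invariant under translation, (Y - 1) - (X - 1)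
  = Y - X. This is why acting by the product of x and v_a agrees with letting x act on each shifted
  letter of v_a separately. The letter v_0 lies outside this picture and needs cases of its own.

  The obstacle to defining the action is that after one bracket v_s is buried inside a commutator,
  while the next letter must still raise its index. Sequences keep this information: starting from
  the letters v_s, v_(s+1), ..., the entry at n is what the same brackets give for v_(s+n), so that
  a shift by m is an evaluation at n + m. It also allows the Leibniz rule \<open>tri_actl\<close> to
  be proved for arbitrary sequences, without reference to v_s.\<close>

definition lin :: "(('a \<Rightarrow>\<^sub>0 rat) \<Rightarrow> ('b \<Rightarrow>\<^sub>0 rat)) \<Rightarrow> bool" where
  "lin f \<longleftrightarrow> (\<forall>p q. f (p + q) = f p + f q) \<and> (\<forall>c p. f (scale c p) = scale c (f p))"

definition bilin :: "(('a \<Rightarrow>\<^sub>0 rat) \<Rightarrow> ('b \<Rightarrow>\<^sub>0 rat) \<Rightarrow> ('c \<Rightarrow>\<^sub>0 rat)) \<Rightarrow> bool" where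
  "bilin f \<longleftrightarrow> (\<forall>p. lin (f p)) \<and> (\<forall>q. lin (\<lambda>p. f p q))"

lemma scale_add_right: "scale c (p + q) = scale c p + scale c q"
  and scale_add_left: "scale (a + b) p = scale a p + scale b p"
  and scale_scale [simp]: "scale a (scale b p) = scale (a * b) p"
  and scale_one [simp]: "scale 1 p = p"
  and scale_zero_left [simp]: "scale 0 p = 0"
  and scale_zero_right [simp]: "scale c 0 = 0"
  and scale_minus_left: "scale (- c) p = - scale c p"
  and scale_diff_right: "scale c (p - q) = scale c p - scale c q"
  by (auto intro!: poly_mapping_eqI simp: lookup_scale lookup_add lookup_minus algebra_simps)

lemma scale_sum: "scale c (sum f A) = (\<Sum>a\<in>A. scale c (f a))"
  by (auto intro!: poly_mapping_eqI simp: lookup_scale lookup_sum sum_distrib_left)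

lemma sum_scale: "scale (sum f A) p = (\<Sum>a\<in>A. scale (f a) p)"
  by (auto intro!: poly_mapping_eqI simp: lookup_scale lookup_sum sum_distrib_right)

lemma scale_eq_mult: "scale c p = Poly_Mapping.single 0 c * (p :: 'a::monoid_add \<Rightarrow>\<^sub>0 rat)"
  by (simp add: scale_def mult_map_scale_conv_mult)

lemma scale_mult_left: "scale c p * q = scale c (p * (q :: 'a::monoid_add \<Rightarrow>\<^sub>0 rat))"
  by (simp add: scale_eq_mult mult.assoc)

lemma linI:
  "(\<And>p q. f (p + q) = f p + f q) \<Longrightarrow> (\<And>c p. f (scale c p) = scale c (f p)) \<Longrightarrow> lin f"
  by (simp add: lin_def)

lemma lin_add: "lin f \<Longrightarrow> f (p + q) = f p + f q"
  and lin_scale: "lin f \<Longrightarrow> f (scale c p) = scale c (f p)"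
  by (simp_all add: lin_def)

lemma lin_0: "lin f \<Longrightarrow> f 0 = 0"
  using lin_scale[of f 0 0] by simp

lemma lin_uminus: "lin f \<Longrightarrow> f (- p) = - f p"
  using lin_scale[of f "-1" p] by (simp add: scale_minus_left)

lemma lin_diff: "lin f \<Longrightarrow> f (p - q) = f p - f q"
  using lin_add[of f p "- q"] by (simp add: lin_uminus)

lemma lin_sum: "lin f \<Longrightarrow> f (sum g A) = (\<Sum>a\<in>A. f (g a))"
  by (induction A rule: infinite_finite_induct) (simp_all add: lin_0 lin_add)

lemma lin_iff_linear: "Vector_Spaces.linear scale scale f \<longleftrightarrow> lin f"
  by (simp add: Vector_Spaces.linear_iff vector_space_scale lin_def)

lemma is_bilinear_iff: "is_bilinear f \<longleftrightarrow> bilin f"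
  by (simp add: is_bilinear_def bilin_def lin_iff_linear)

lemma bilin_lin: "bilin f \<Longrightarrow> lin (f p)" "bilin f \<Longrightarrow> lin (\<lambda>p. f p q)"
  by (simp_all add: bilin_def)

lemma basis_expansion: "p = (\<Sum>a\<in>Poly_Mapping.keys p. scale (Poly_Mapping.lookup p a) (Poly_Mapping.single a 1))"
proof (rule poly_mapping_eqI)
  fix k
  have "(\<Sum>a\<in>Poly_Mapping.keys p. Poly_Mapping.lookup p a * (1 when a = k))
      = (\<Sum>a\<in>Poly_Mapping.keys p. Poly_Mapping.lookup p k when a = k)"
    by (rule sum.cong) (auto simp: when_def)
  also have "\<dots> = Poly_Mapping.lookup p k"
    by (simp add: when_def in_keys_iff)
  finally show "Poly_Mapping.lookup p k = Poly_Mapping.lookup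
      (\<Sum>a\<in>Poly_Mapping.keys p. scale (Poly_Mapping.lookup p a) (Poly_Mapping.single a 1)) k"
    by (simp add: lookup_sum lookup_scale lookup_single)
qed

lemma basis_induct [case_names single add scale]:
  assumes "\<And>a. P (Poly_Mapping.single a 1)"
    and "\<And>p q. P p \<Longrightarrow> P q \<Longrightarrow> P (p + q)"
    and "\<And>c p. P p \<Longrightarrow> P (scale c p)"
  shows "P (p :: 'a \<Rightarrow>\<^sub>0 rat)"
proof -
  have "P 0"
    using assms(3)[OF assms(1), of 0 undefined] by simp
  then have "P (\<Sum>a\<in>A. scale (g a) (Poly_Mapping.single a 1))" for A and g :: "'a \<Rightarrow> rat"
    by (induction A rule: infinite_finite_induct) (simp_all add: assms)
  then show ?thesis
    by (subst basis_expansion)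
qed

lemma lin_ext_superset:
  assumes "finite B" "Poly_Mapping.keys p \<subseteq> B"
  shows "lin_ext f p = (\<Sum>a\<in>B. scale (Poly_Mapping.lookup p a) (f a))"
  unfolding lin_ext_def
  by (rule sum.mono_neutral_left) (use assms in \<open>auto simp: in_keys_iff\<close>)

lemma lin_lin_ext: "lin (lin_ext f)"
proof (rule linI)
  fix p q :: "'a \<Rightarrow>\<^sub>0 rat"
  let ?B = "Poly_Mapping.keys p \<union> Poly_Mapping.keys q"
  have "Poly_Mapping.keys (p + q) \<subseteq> ?B" by (rule keys_add)
  then show "lin_ext f (p + q) = lin_ext f p + lin_ext f q"
    by (simp add: lin_ext_superset[of ?B] lookup_add scale_add_left sum.distrib)
next
  fix c and p :: "'a \<Rightarrow>\<^sub>0 rat"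
  have "Poly_Mapping.keys (scale c p) \<subseteq> Poly_Mapping.keys p"
    by (auto simp: in_keys_iff lookup_scale)
  then show "lin_ext f (scale c p) = scale c (lin_ext f p)"
    by (simp add: lin_ext_superset[of "Poly_Mapping.keys p"] lookup_scale scale_sum)
qed

lemmas lin_ext_linear [simp] =
  lin_add[OF lin_lin_ext] lin_scale[OF lin_lin_ext] lin_0[OF lin_lin_ext] lin_uminus[OF lin_lin_ext]
  lin_diff[OF lin_lin_ext]

lemma lin_ext_single [simp]: "lin_ext f (Poly_Mapping.single a 1) = f a"
  by (simp add: lin_ext_def)

lemma lin_eqI:
  assumes "lin f" "lin g" "\<And>a. f (Poly_Mapping.single a 1) = g (Poly_Mapping.single a 1)"
  shows "f p = g p"
  by (induction p rule: basis_induct) (use assms in \<open>simp_all add: lin_def\<close>)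

lemma lin_comp: "lin f \<Longrightarrow> lin g \<Longrightarrow> lin (\<lambda>p. f (g p))"
  by (simp add: lin_def)

lemma lin_minus: "lin f \<Longrightarrow> lin g \<Longrightarrow> lin (\<lambda>p. f p - g p)"
  by (simp add: lin_def scale_diff_right)

lemma lin_id [simp]: "lin (\<lambda>p. p)"
  by (simp add: lin_def)

lemma lin_ext_fun_add: "lin_ext (\<lambda>a. f a + g a) p = lin_ext f p + lin_ext g p"
  by (simp add: lin_ext_def scale_add_right sum.distrib)

lemma lin_ext_fun_diff: "lin_ext (\<lambda>a. f a - g a) p = lin_ext f p - lin_ext g p"
  by (simp add: lin_ext_def scale_diff_right sum_subtractf)

lemma lin_ext_fun_scale: "lin_ext (\<lambda>a. scale c (f a)) p = scale c (lin_ext f p)"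
  by (simp add: lin_ext_def scale_sum mult.commute)

lemma lin_lin_ext_fun: "(\<And>a. lin (f a)) \<Longrightarrow> lin (\<lambda>q. lin_ext (\<lambda>a. f a q) p)"
  by (simp add: lin_def lin_ext_fun_add lin_ext_fun_scale)

lemma lin_ext_comp: "lin h \<Longrightarrow> h (lin_ext f p) = lin_ext (\<lambda>a. h (f a)) p"
  by (simp add: lin_ext_def lin_sum lin_scale)

lemma bilin_bilin_ext: "bilin (bilin_ext f)"
  unfolding bilin_def bilin_ext_def by (auto intro!: lin_lin_ext lin_lin_ext_fun)

lemma bilin_ext_single [simp]:
  "bilin_ext f (Poly_Mapping.single a 1) (Poly_Mapping.single b 1) = f a b"
  by (simp add: bilin_ext_def)

lemma bilin_eqI:
  assumes "bilin f" "bilin g"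
    and "\<And>a b. f (Poly_Mapping.single a 1) (Poly_Mapping.single b 1) =
      g (Poly_Mapping.single a 1) (Poly_Mapping.single b 1)"
  shows "f p q = g p q"
proof -
  have "f (Poly_Mapping.single a 1) q = g (Poly_Mapping.single a 1) q" for a
    by (rule lin_eqI[of "f (Poly_Mapping.single a 1)" "g (Poly_Mapping.single a 1)"])
      (use assms in \<open>simp_all add: bilin_def\<close>)
  with assms show ?thesis
    by - (rule lin_eqI[of "\<lambda>p. f p q" "\<lambda>p. g p q"], simp_all add: bilin_def)
qed

section \<open>The pairing with orthonormal words\<close>

lemma pairing_add_left: "pairing (p + q) r = pairing p r + pairing q r"
  and pairing_scale_left: "pairing (scale c p) r = c * pairing p r"
  and pairing_single_left: "pairing (Poly_Mapping.single a 1) r = Poly_Mapping.lookup r a"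
proof -
  have superset: "pairing p r = (\<Sum>a\<in>B. Poly_Mapping.lookup p a * Poly_Mapping.lookup r a)"
    if "finite B" "Poly_Mapping.keys p \<subseteq> B" for p B
    unfolding pairing_def
    by (rule sum.mono_neutral_left) (use that in \<open>auto simp: in_keys_iff\<close>)
  have "Poly_Mapping.keys (p + q) \<subseteq> Poly_Mapping.keys p \<union> Poly_Mapping.keys q" by (rule keys_add)
  then show "pairing (p + q) r = pairing p r + pairing q r"
    by (simp add: superset[of "Poly_Mapping.keys p \<union> Poly_Mapping.keys q"] lookup_add
        algebra_simps sum.distrib)
  have "Poly_Mapping.keys (scale c p) \<subseteq> Poly_Mapping.keys p"
    by (auto simp: in_keys_iff lookup_scale)
  then show "pairing (scale c p) r = c * pairing p r"
    by (simp add: superset[of "Poly_Mapping.keys p"] lookup_scale sum_distrib_left mult.assoc)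
  show "pairing (Poly_Mapping.single a 1) r = Poly_Mapping.lookup r a"
    by (simp add: pairing_def)
qed

lemma pairing_single_right: "pairing p (Poly_Mapping.single a 1) = Poly_Mapping.lookup p a"
  by (induction p rule: basis_induct)
    (simp_all add: pairing_add_left pairing_scale_left pairing_single_left lookup_add lookup_scale
      lookup_single when_def)

subsection \<open>Words\<close>

lemma scale_mult_right: "p * scale c q = scale c (p * (q :: 'a::monoid_add \<Rightarrow>\<^sub>0 rat))"
proof -
  have "Poly_Mapping.single 0 c * (p :: 'a::monoid_add \<Rightarrow>\<^sub>0 rat) = p * Poly_Mapping.single 0 c"
  proof (induction p rule: basis_induct)
    case (single a)
    then show ?case by (simp add: mult_single)
  next
    case (add p q)
    then show ?case by (simp add: distrib_left distrib_right)
  next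
    case (scale d p)
    have "Poly_Mapping.single 0 c * scale d p = Poly_Mapping.single 0 d * (Poly_Mapping.single 0 c * p)"
      by (simp add: scale_eq_mult mult_single mult.commute flip: mult.assoc)
    then show ?case by (simp add: scale scale_mult_left) (simp add: scale_eq_mult)
  qed
  then show ?thesis
    by (simp add: scale_eq_mult flip: mult.assoc)
qed

lemma lin_mult_left: "lin f \<Longrightarrow> lin (\<lambda>p. f p * (q :: 'a::monoid_add \<Rightarrow>\<^sub>0 rat))"
  by (simp add: lin_def distrib_right scale_mult_left)

lemma lin_mult_right: "lin f \<Longrightarrow> lin (\<lambda>p. (q :: 'a::monoid_add \<Rightarrow>\<^sub>0 rat) * f p)"
  by (simp add: lin_def distrib_left scale_mult_right)

lemma vword_Nil: "vword [] = 1"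
  by (simp add: vword_def zero_word_def flip: single_one)

lemma vword_append: "vword (u @ w) = vword u * vword w"
  by (simp add: vword_def mult_single)

lemma vword_Cons: "vword (a # w) = letter a * vword w"
  using vword_append[of "[a]" w] by simp

lemma single_Word: "Poly_Mapping.single (Word u) 1 = vword u"
  by (simp add: vword_def)

lemma word_induct [case_names vword add scale]:
  assumes "\<And>w. P (vword w)"
    and "\<And>p q. P p \<Longrightarrow> P q \<Longrightarrow> P (p + q)"
    and "\<And>c p. P p \<Longrightarrow> P (scale c p)"
  shows "P p"
proof (induction p rule: basis_induct)
  case (single a)
  then show ?case using assms(1) by (cases a) (simp add: vword_def)
qed (use assms in auto)

lemma bilin_ext_vword: "bilin_ext f (vword u) (vword w) = f (Word u) (Word w)"
  by (simp add: vword_def)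

lemma lin_ext_vword: "lin_ext f (vword u) = f (Word u)"
  by (simp add: vword_def)

subsection \<open>Sums over unshuffles\<close>

text \<open>The coproduct of a word in Sweedler form, as a functional: the sum of \<open>F u_(1) u_(2)\<close>.\<close>

fun unshuffle_sum :: "(nat list \<Rightarrow> nat list \<Rightarrow> 'b::comm_monoid_add) \<Rightarrow> nat list \<Rightarrow> 'b" where
  "unshuffle_sum F [] = F [] []"
| "unshuffle_sum F (a # u) = unshuffle_sum (\<lambda>p q. F (a # p) q) u + unshuffle_sum (\<lambda>p q. F p (a # q)) u"

lemma unshuffle_sum_zero [simp]: "unshuffle_sum (\<lambda>p q. 0) u = 0"
  by (induction u) simp_all

lemma unshuffle_sum_add:
  "unshuffle_sum (\<lambda>p q. F p q + G p q) u = unshuffle_sum F u + unshuffle_sum G u"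
  by (induction u arbitrary: F G) (simp_all add: ac_simps)

lemma unshuffle_sum_hom:
  assumes "\<And>x y. h (x + y) = h x + h y"
  shows "h (unshuffle_sum F u) = unshuffle_sum (\<lambda>p q. h (F p q)) u"
  by (induction u arbitrary: F) (simp_all add: assms)

lemma unshuffle_sum_sum:
  "unshuffle_sum (\<lambda>p q. \<Sum>i\<in>A. F i p q) u = (\<Sum>i\<in>A. unshuffle_sum (F i) u)"
  by (induction u arbitrary: F) (simp_all add: sum.distrib)

lemma unshuffle_sum_cong:
  assumes "\<And>p q. length p + length q = length u \<Longrightarrow> F p q = G p q"
  shows "unshuffle_sum F u = unshuffle_sum G u"
  using assms
proof (induction u arbitrary: F G)
  case (Cons a u)
  have "unshuffle_sum (\<lambda>p q. F (a # p) q) u = unshuffle_sum (\<lambda>p q. G (a # p) q) u"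
    and "unshuffle_sum (\<lambda>p q. F p (a # q)) u = unshuffle_sum (\<lambda>p q. G p (a # q)) u"
    by (rule Cons.IH, simp add: Cons.prems)+
  then show ?case by simp
qed simp

text \<open>Counit law of the unshuffle coproduct. Together with its mirror image it is applied
  whenever one factor is supported on the empty word.\<close>

lemma unshuffle_sum_Nil_left:
  "unshuffle_sum (\<lambda>p q. if p = [] then F q else 0) u = F u"
  by (induction u arbitrary: F) simp_all

lemma unshuffle_sum_Nil_right:
  "unshuffle_sum (\<lambda>p q. if q = [] then F p else 0) u = F u"
  by (induction u arbitrary: F) simp_all

text \<open>Coassociativity: both sides distribute the letters of u over three words.\<close>

lemma unshuffle_sum_assoc:
  "unshuffle_sum (\<lambda>p q. unshuffle_sum (\<lambda>r s. F r s q) p) u =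
   unshuffle_sum (\<lambda>p q. unshuffle_sum (\<lambda>r s. F p r s) q) u"
  by (induction u arbitrary: F) (simp_all add: unshuffle_sum_add ac_simps)

section \<open>Coefficients of words\<close>

abbreviation cf :: "QV \<Rightarrow> nat list \<Rightarrow> rat" where
  "cf X u \<equiv> Poly_Mapping.lookup X (Word u)"

lemma cf_vword: "cf (vword w) u = (if w = u then 1 else 0)"
  by (simp add: vword_def lookup_single when_def)

lemma cf_one: "cf 1 u = (if u = [] then 1 else 0)"
  by (simp add: cf_vword eq_commute flip: vword_Nil)

lemma QV_eqI: "(\<And>u. cf X u = cf Y u) \<Longrightarrow> X = Y"
  by (rule poly_mapping_eqI) (metis word.exhaust)

lemma cf_mult: "cf (X * Y) u = (\<Sum>i\<le>length u. cf X (take i u) * cf Y (drop i u))"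
proof (induction X rule: word_induct)
  case (vword x)
  show ?case
  proof (induction Y rule: word_induct)
    case (vword y)
    have "(\<Sum>i\<le>length u. cf (vword x) (take i u) * cf (vword y) (drop i u)) =
        (\<Sum>i\<le>length u. if i = length x then (if u = x @ y then 1 else 0) else 0)"
    proof (rule sum.cong)
      fix i assume "i \<in> {..length u}"
      then have *: "x = take i u \<and> y = drop i u \<longleftrightarrow> i = length x \<and> u = x @ y"
        by (auto simp: min_def)
      have "cf (vword x) (take i u) * cf (vword y) (drop i u) =
          (if x = take i u \<and> y = drop i u then 1 else 0)"
        by (simp add: cf_vword)
      also have "\<dots> = (if i = length x then (if u = x @ y then 1 else 0) else 0)"
        by (simp only: *) simp
      finally show "cf (vword x) (take i u) * cf (vword y) (drop i u) =
          (if i = length x then (if u = x @ y then 1 else 0) else 0)" .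
    qed simp
    then show ?case
      by (auto simp: cf_vword simp flip: vword_append)
  qed (simp_all add: distrib_left lookup_add scale_mult_right lookup_scale sum.distrib
      sum_distrib_left mult.left_commute)
qed (simp_all add: distrib_right lookup_add scale_mult_left lookup_scale sum.distrib
      sum_distrib_left mult.assoc)

lemma cf_mult_Nil: "cf (X * Y) [] = cf X [] * cf Y []"
  by (simp add: cf_mult)

lemma cf_letter_mult_Nil: "cf (letter a * X) [] = 0"
  by (simp add: cf_mult_Nil cf_vword)

lemma cf_letter_mult_Cons: "cf (letter a * X) (b # u) = (if a = b then cf X u else 0)"
  by (induction X rule: word_induct)
    (auto simp: cf_vword distrib_left lookup_add scale_mult_right lookup_scale simp flip: vword_Cons)

lemma lin_lin_ext': "lin g \<Longrightarrow> lin (\<lambda>p. lin_ext f (g p))"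
  by (rule lin_comp[OF lin_lin_ext])

lemma lin_bilin_ext_left: "lin g \<Longrightarrow> lin (\<lambda>p. bilin_ext f (g p) q)"
  using lin_comp[OF bilin_lin(2)[OF bilin_bilin_ext]] .

lemma lin_bilin_ext_right: "lin g \<Longrightarrow> lin (\<lambda>q. bilin_ext f p (g q))"
  using lin_comp[OF bilin_lin(1)[OF bilin_bilin_ext]] .

subsection \<open>Shuffle product and coproduct\<close>

text \<open>Both recursions look at the first letter: that of u has to be the head of x or the head
  of y, and it is removed from u and from the word in which it was found.\<close>

lemma cf_shuffle_list:
  "cf (shuffle_list x y) u = unshuffle_sum (\<lambda>p q. if p = x then (if q = y then 1 else 0) else 0) u"
proof (induction x y arbitrary: u rule: shuffle_list.induct)
  case (1 y)
  then show ?case by (simp add: unshuffle_sum_Nil_left cf_vword eq_commute)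
next
  case (2 a x)
  have "unshuffle_sum (\<lambda>p q. if p = a # x then (if q = [] then 1 else 0) else (0 :: rat)) u =
      unshuffle_sum (\<lambda>p q. if q = [] then (if p = a # x then 1 else 0) else 0) u"
    by (rule unshuffle_sum_cong) simp
  also have "\<dots> = cf (shuffle_list (a # x) []) u"
    by (simp only: unshuffle_sum_Nil_right cf_vword shuffle_list.simps) auto
  finally show ?case by simp
next
  case (3 a x b y)
  show ?case
  proof (cases u)
    case Nil
    then show ?thesis by (simp add: lookup_add cf_letter_mult_Nil)
  next
    case (Cons c v)
    have *: "unshuffle_sum (\<lambda>p q. if c # p = a # x then (if q = b # y then 1 else 0) else 0) v =
        (if a = c then cf (shuffle_list x (b # y)) v else 0)"
      by (auto simp: 3)
    have "unshuffle_sum (\<lambda>p q. if p = a # x then (if c # q = b # y then 1 else 0) else 0) v =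
        unshuffle_sum (\<lambda>p q. if b = c then (if p = a # x then (if q = y then 1 else 0) else (0 :: rat)) else 0) v"
      by (rule unshuffle_sum_cong) auto
    also have "\<dots> = (if b = c then cf (shuffle_list (a # x) y) v else 0)"
      by (simp only: 3 unshuffle_sum_zero split: if_split) simp
    finally have **: "unshuffle_sum (\<lambda>p q. if p = a # x then (if c # q = b # y then 1 else 0) else 0) v =
        (if b = c then cf (shuffle_list (a # x) y) v else 0)" .
    from * ** show ?thesis
      by (simp only: Cons lookup_add shuffle_list.simps unshuffle_sum.simps cf_letter_mult_Cons)
  qed
qed

lemma lin_shuffle: "lin g \<Longrightarrow> lin (\<lambda>p. shuffle (g p) q)" "lin g \<Longrightarrow> lin (\<lambda>p. shuffle q (g p))"
  unfolding shuffle_def by (auto intro!: lin_bilin_ext_left lin_bilin_ext_right)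

lemmas shuffle_linear =
  lin_add[OF lin_shuffle(1)[OF lin_id]] lin_scale[OF lin_shuffle(1)[OF lin_id]]
  lin_add[OF lin_shuffle(2)[OF lin_id]] lin_scale[OF lin_shuffle(2)[OF lin_id]]

lemma cf_shuffle: "cf (shuffle X Y) u = unshuffle_sum (\<lambda>p q. cf X p * cf Y q) u"
proof (induction X rule: word_induct)
  case (vword x)
  show ?case
  proof (induction Y rule: word_induct)
    case (vword y)
    show ?case
      by (auto simp: shuffle_def bilin_ext_vword cf_shuffle_list cf_vword intro!: unshuffle_sum_cong)
  qed (simp_all add: shuffle_linear lookup_add lookup_scale distrib_left unshuffle_sum_add
      mult.left_commute flip: unshuffle_sum_hom[of "\<lambda>x. _ * x", OF distrib_left])
qed (simp_all add: shuffle_linear lookup_add lookup_scale distrib_right unshuffle_sum_add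
      mult.assoc flip: unshuffle_sum_hom[of "\<lambda>x. _ * x", OF distrib_left])

text \<open>Comparing coefficients reduces associativity to coassociativity of unshuffling.\<close>

lemma shuffle_assoc: "shuffle (shuffle X Y) Z = shuffle X (shuffle Y Z)"
proof (rule QV_eqI)
  fix u
  have "cf (shuffle (shuffle X Y) Z) u =
      unshuffle_sum (\<lambda>p q. unshuffle_sum (\<lambda>r s. cf X r * cf Y s * cf Z q) p) u"
    by (simp add: cf_shuffle unshuffle_sum_hom[of "\<lambda>x. x * _", OF distrib_right])
  also have "\<dots> = unshuffle_sum (\<lambda>p q. unshuffle_sum (\<lambda>r s. cf X p * cf Y r * cf Z s) q) u"
    by (rule unshuffle_sum_assoc)
  also have "\<dots> = cf (shuffle X (shuffle Y Z)) u"
    by (simp add: cf_shuffle unshuffle_sum_hom[of "\<lambda>x. _ * x", OF distrib_left] mult.assoc)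
  finally show "cf (shuffle (shuffle X Y) Z) u = cf (shuffle X (shuffle Y Z)) u" .
qed

lemma shuffle_one_right [simp]: "shuffle X 1 = X"
proof (rule QV_eqI)
  fix u
  have "cf (shuffle X 1) u = unshuffle_sum (\<lambda>p q. if q = [] then cf X p else 0) u"
    unfolding cf_shuffle by (auto simp: cf_one intro!: unshuffle_sum_cong)
  then show "cf (shuffle X 1) u = cf X u"
    by (simp add: unshuffle_sum_Nil_right)
qed

lemma shuffle_one_left [simp]: "shuffle 1 X = X"
proof (rule QV_eqI)
  fix u
  have "cf (shuffle 1 X) u = unshuffle_sum (\<lambda>p q. if p = [] then cf X q else 0) u"
    unfolding cf_shuffle by (auto simp: cf_one intro!: unshuffle_sum_cong)
  then show "cf (shuffle 1 X) u = cf X u"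
    by (simp add: unshuffle_sum_Nil_left)
qed

lemma coprod_word_unshuffle:
  "coprod_word (Word w) = unshuffle_sum (\<lambda>p q. Poly_Mapping.single (Word p, Word q) 1) w"
proof (induction w)
  case Nil
  show ?case by (simp add: zero_word_def flip: single_one) (simp add: zero_prod_def zero_word_def)
next
  case (Cons a w)
  have "tensor (letter a) 1 = Poly_Mapping.single (Word [a], Word []) 1"
    and "tensor 1 (letter a) = Poly_Mapping.single (Word [], Word [a]) 1"
    by (simp_all add: tensor_def bilin_ext_vword flip: vword_Nil)
  with Cons show ?case
    by (simp add: distrib_right unshuffle_sum_hom[of "\<lambda>x. _ * x", OF distrib_left] mult_single
        unshuffle_sum_add)
qed

lemma lin_sweedler: "lin g \<Longrightarrow> lin (\<lambda>A. sweedler f (g A))"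
  unfolding sweedler_def coprod_def by (intro lin_lin_ext')

lemmas sweedler_linear =
  lin_add[OF lin_sweedler[OF lin_id]] lin_scale[OF lin_sweedler[OF lin_id]]
  lin_diff[OF lin_sweedler[OF lin_id]] lin_0[OF lin_sweedler[OF lin_id]]

lemma sweedler_vword:
  "sweedler f (vword w) = unshuffle_sum (\<lambda>p q. f (vword p) (vword q)) w"
  by (simp add: sweedler_def coprod_def lin_ext_vword coprod_word_unshuffle
      unshuffle_sum_hom[of "lin_ext _"] single_Word del: coprod_word.simps)

lemma sweedler_fun_add: "sweedler (\<lambda>a b. f a b + g a b) A = sweedler f A + sweedler g A"
  unfolding sweedler_def by (subst lin_ext_fun_add[symmetric]) (simp add: case_prod_beta')

lemma sweedler_fun_diff: "sweedler (\<lambda>a b. f a b - g a b) A = sweedler f A - sweedler g A"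
  unfolding sweedler_def by (subst lin_ext_fun_diff[symmetric]) (simp add: case_prod_beta')

lemma sweedler_fun_scale: "sweedler (\<lambda>a b. scale c (f a b)) A = scale c (sweedler f A)"
  unfolding sweedler_def by (subst lin_ext_fun_scale[symmetric]) (simp add: case_prod_beta')

lemma sweedler_comp: "lin h \<Longrightarrow> h (sweedler f A) = sweedler (\<lambda>a b. h (f a b)) A"
  unfolding sweedler_def by (simp add: lin_ext_comp case_prod_beta')

lemma lin_sweedler_fun: "(\<And>a b. lin (f a b)) \<Longrightarrow> lin (\<lambda>p. sweedler (\<lambda>a b. f a b p) A)"
  by (simp add: lin_def sweedler_fun_add sweedler_fun_scale)

lemma sweedler_one: "sweedler f 1 = f 1 1"
  using sweedler_vword[of f "[]"] by (simp add: vword_Nil)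

subsection \<open>Lie elements\<close>

definition comm :: "QV \<Rightarrow> QV \<Rightarrow> QV" where
  "comm x y = x * y - y * x"

lemma lin_comm: "lin f \<Longrightarrow> lin (\<lambda>p. comm (f p) y)" "lin f \<Longrightarrow> lin (\<lambda>p. comm y (f p))"
  unfolding comm_def by (auto intro!: lin_minus lin_mult_left lin_mult_right)

lemmas comm_linear =
  lin_add[OF lin_comm(1)[OF lin_id]] lin_scale[OF lin_comm(1)[OF lin_id]]
  lin_sum[OF lin_comm(1)[OF lin_id]] lin_0[OF lin_comm(1)[OF lin_id]]
  lin_add[OF lin_comm(2)[OF lin_id]] lin_scale[OF lin_comm(2)[OF lin_id]]
  lin_sum[OF lin_comm(2)[OF lin_id]] lin_0[OF lin_comm(2)[OF lin_id]]

text \<open>The Jacobi identity arranged for right brackets: bracketing with a commutator is the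
  commutator of the two bracketings. In this form it makes the right adjoint action compatible with
  Lie brackets.\<close>

lemma comm_jacobi: "comm (comm x y) z - comm (comm x z) y = comm x (comm y z)"
  by (simp add: comm_def algebra_simps)

lemma lie_proj_single: "lie_proj (Poly_Mapping.single t 1) = lie_proj_basis t"
  by (simp add: lie_proj_def)

lemma lin_lie_proj: "lin f \<Longrightarrow> lin (\<lambda>p. lie_proj (f p))"
  unfolding lie_proj_def by (rule lin_lin_ext')

lemmas lie_proj_linear =
  lin_add[OF lin_lie_proj[OF lin_id]] lin_scale[OF lin_lie_proj[OF lin_id]]
  lin_sum[OF lin_lie_proj[OF lin_id]] lin_0[OF lin_lie_proj[OF lin_id]]

lemma lie_proj_in_Lie: "lie_proj p \<in> Lie"
  by (simp add: Lie_def)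

lemma lie_proj_basis_in_Lie: "lie_proj_basis t \<in> Lie"
  using lie_proj_in_Lie[of "Poly_Mapping.single t 1"] by (simp add: lie_proj_single)

lemma letter_in_Lie: "letter i \<in> Lie"
  using lie_proj_basis_in_Lie[of "Gen i"] by simp

lemma Lie_induct [consumes 1, case_names magma add scale]:
  assumes "x \<in> Lie" "\<And>t. P (lie_proj_basis t)"
    and "\<And>p q. P p \<Longrightarrow> P q \<Longrightarrow> P (p + q)" "\<And>c p. P p \<Longrightarrow> P (scale c p)"
  shows "P x"
proof -
  have "P (lie_proj p)" for p
    by (induction p rule: basis_induct) (simp_all add: assms lie_proj_single lie_proj_linear)
  with assms(1) show ?thesis by (auto simp: Lie_def)
qed

lemma cf_Lie_Nil: "x \<in> Lie \<Longrightarrow> cf x [] = 0"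
proof (induction x rule: Lie_induct)
  case (magma t)
  show ?case by (induction t) (simp_all add: cf_vword lookup_minus cf_mult_Nil)
qed (simp_all add: lookup_add lookup_scale)

lemma sweedler_letter_mult:
  "sweedler f (letter a * W) = sweedler (\<lambda>p q. f (letter a * p) q + f p (letter a * q)) W"
proof (induction W rule: word_induct)
  case (vword w)
  show ?case
    by (simp only: vword_Cons[symmetric] sweedler_vword unshuffle_sum.simps unshuffle_sum_add)
qed (simp_all add: distrib_left sweedler_linear scale_mult_right)

text \<open>Lie elements are primitive: letters are, and in a commutator of two primitive elements
  the mixed terms cancel.\<close>

lemma sweedler_Lie_mult:
  assumes "z \<in> Lie" "bilin f"
  shows "sweedler f (z * W) = sweedler (\<lambda>p q. f (z * p) q + f p (z * q)) W"
  using assms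
proof (induction z arbitrary: f W rule: Lie_induct)
  case (magma t)
  then show ?case
  proof (induction t arbitrary: f W)
    case (Gen i)
    then show ?case by (simp add: sweedler_letter_mult)
  next
    case (Star t1 t2)
    let ?x = "lie_proj_basis t1" and ?y = "lie_proj_basis t2"
    \<comment> \<open>Each product of two factors uses both induction hypotheses, the second one for
      the functional that the first has produced; this functional must again be bilinear.\<close>
    have bil: "bilin (\<lambda>p q. f (z * p) q + f p (z * q))" for z
      using Star.prems
      by (auto simp: bilin_def lin_def distrib_left scale_mult_right scale_add_right)
    have eq: "sweedler f (?x * (?y * W)) = sweedler (\<lambda>p q. (f (?x * (?y * p)) q + f (?y * p) (?x * q))
          + (f (?x * p) (?y * q) + f p (?x * (?y * q)))) W"
      "sweedler f (?y * (?x * W)) = sweedler (\<lambda>p q. (f (?y * (?x * p)) q + f (?x * p) (?y * q))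
          + (f (?y * p) (?x * q) + f p (?y * (?x * q)))) W"
      by (simp_all only: Star.IH(1)[OF Star.prems] Star.IH(2)[OF Star.prems] Star.IH(1)[OF bil]
          Star.IH(2)[OF bil])
    have "f (x - y) q = f x q - f y q" "f p (x - y) = f p x - f p y" for x y p q
      using Star.prems by (auto simp: bilin_def lin_diff lin_diff[of "\<lambda>p. f p q"])
    then show ?case
      by (simp add: left_diff_distrib mult.assoc sweedler_linear eq flip: sweedler_fun_diff)
        (simp add: algebra_simps)
  qed
next
  case (add p q)
  then show ?case
    by (simp add: distrib_right sweedler_linear flip: sweedler_fun_add)
       (simp add: bilin_def lin_def add_ac)
next
  case (scale c p)
  then show ?case
    by (simp add: scale_mult_left sweedler_linear flip: sweedler_fun_scale)
       (simp add: bilin_def lin_def scale_add_right)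
qed

lemma sweedler_Lie: "z \<in> Lie \<Longrightarrow> bilin f \<Longrightarrow> sweedler f z = f z 1 + f 1 z"
  using sweedler_Lie_mult[of z f 1] by (simp add: sweedler_one)

subsection \<open>The ari multiplicity\<close>

definition ari :: "nat \<Rightarrow> nat \<Rightarrow> rat" where
  "ari k l = (- 1) ^ (k + l) * of_nat (pred_binom k l)"

lemma ari_0_0 [simp]: "ari 0 0 = 1"
  and ari_0_right: "k > 0 \<Longrightarrow> ari k 0 = 0"
  by (simp_all add: ari_def pred_binom_def)

lemma ari_eq_0: "k < l \<Longrightarrow> ari k l = 0"
  by (auto simp: ari_def pred_binom_def)

lemma ari_Suc_Suc: "ari (Suc k) (Suc l) = (- 1) ^ (k + l) * of_nat (k choose l)"
  by (simp add: ari_def pred_binom_def)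

lemma ari_mult_Nil [simp]: "ari_mult [] [] = 1"
  by (simp add: ari_mult_def)

lemma ari_mult_Cons: "ari_mult (k # ks) (l # ls) = ari k l * ari_mult ks ls"
  by (simp add: ari_mult_def ari_def power_add prod.lessThan_Suc_shift del: prod.lessThan_Suc)

lemma ari_mult_append:
  "length ks = length ls \<Longrightarrow> ari_mult (ks @ ks') (ls @ ls') = ari_mult ks ls * ari_mult ks' ls'"
  by (induction ks ls rule: list_induct2) (simp_all add: ari_mult_Cons)

text \<open>Serves the letters in front of position j in a block, which the antipode
  reverses.\<close>

lemma ari_mult_rev: "length ks = length ls \<Longrightarrow> ari_mult (rev ks) (rev ls) = ari_mult ks ls"
  by (induction ks ls rule: list_induct2) (simp_all add: ari_mult_append ari_mult_Cons)

text \<open>Pascal's rule in the form of summation by parts: up to sign, a difference of order M + 1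
  is the difference of order M of a first difference.\<close>

lemma binomial_difference:
  fixes f :: "nat \<Rightarrow> rat"
  shows "(\<Sum>j\<le>Suc M. (- 1) ^ j * of_nat (Suc M choose j) * f j) =
    (\<Sum>j\<le>M. (- 1) ^ j * of_nat (M choose j) * (f j - f (Suc j)))"
proof -
  have "(\<Sum>j\<le>Suc M. (- 1) ^ j * of_nat (Suc M choose j) * f j) =
      f 0 - (\<Sum>j\<le>M. (- 1) ^ j * of_nat (M choose j) * f (Suc j))
          - (\<Sum>j\<le>M. (- 1) ^ j * of_nat (M choose Suc j) * f (Suc j))"
    by (subst sum.atMost_Suc_shift)
      (simp add: distrib_left distrib_right sum.distrib sum_negf sum_subtractf algebra_simps)
  moreover have "(\<Sum>j\<le>M. (- 1) ^ j * of_nat (M choose j) * f j) =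
      f 0 - (\<Sum>j\<le>M. (- 1) ^ j * of_nat (M choose Suc j) * f (Suc j))"
  proof -
    have "(\<Sum>j\<le>M. (- 1) ^ j * of_nat (M choose j) * f j) =
        (\<Sum>j\<le>Suc M. (- 1) ^ j * of_nat (M choose j) * f j)"
      by simp
    also have "\<dots> = f 0 - (\<Sum>j\<le>M. (- 1) ^ j * of_nat (M choose Suc j) * f (Suc j))"
      by (subst sum.atMost_Suc_shift) (simp add: sum_negf)
    finally show ?thesis .
  qed
  ultimately show ?thesis
    by (simp add: right_diff_distrib sum_subtractf)
qed

text \<open>By Pascal's rule every difference lowers the lower index r by one, so M of them lower it
  by M, or give 0 once r is used up.\<close>

lemma sum_binomial_alternating:
  "(\<Sum>j\<le>M. (- 1) ^ j * of_nat (M choose j) * of_nat ((c + (M - j)) choose r)) =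
   (if M \<le> r then of_nat (c choose (r - M)) else (0 :: rat))"
proof (induction M arbitrary: c r)
  case 0
  show ?case by simp
next
  case (Suc M)
  show ?case
  proof (cases r)
    case 0
    have "(\<Sum>j\<le>Suc M. (- 1) ^ j * of_nat (Suc M choose j) * (1::rat)) = 0"
      unfolding binomial_difference by simp
    then show ?thesis by (simp add: 0 del: sum.atMost_Suc)
  next
    case (Suc r')
    have *: "(\<Sum>j\<le>Suc M. (- 1) ^ j * of_nat (Suc M choose j) * of_nat ((c + (Suc M - j)) choose r)) =
        (\<Sum>j\<le>M. (- 1) ^ j * of_nat (M choose j) * of_nat ((c + (M - j)) choose r') :: rat)"
      unfolding binomial_difference
      by (intro sum.cong refl) (simp add: Suc Suc_diff_le)
    show ?thesis
      unfolding * Suc.IH by (simp add: Suc)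
  qed
qed

text \<open>For positive k and l, \<open>ari k l\<close> is the coefficient of \<open>X^(l-1)\<close> in \<open>(X - 1)^(k-1)\<close>.\<close>

lemma ari_shift:
  assumes "k > 0" "b \<le> a"
  shows "(\<Sum>l\<le>a. ari a l * ari l b * ari (k + (a - l)) c) =
    (if a \<le> c + b then ari a b * ari k (c + b - a) else 0)"
proof (cases "a = 0")
  case True
  with assms show ?thesis by simp
next
  case a: False
  obtain k' where k: "k = Suc k'" using assms by (cases k) auto
  show ?thesis
  proof (cases "b = 0")
    case True
    have "ari a l * ari l b = 0" for l
      using True a by (cases "l = 0") (simp_all add: ari_0_right)
    then have "(\<Sum>l\<le>a. ari a l * ari l b * ari (k + (a - l)) c) = 0"
      by (intro sum.neutral ballI) simp
    with True a show ?thesis by (simp add: ari_0_right)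
  next
    case False
    then obtain b' where b: "b = Suc b'" by (cases b) auto
    with assms obtain M where M: "a = Suc (b' + M)"
      by (metis add_Suc le_Suc_ex)
    have "(\<Sum>l\<le>a. ari a l * ari l b * ari (k + (a - l)) c) =
        (\<Sum>l\<in>{b..a}. ari a l * ari l b * ari (k + (a - l)) c)"
      by (rule sum.mono_neutral_right) (auto simp: ari_eq_0)
    also have "\<dots> = (\<Sum>j\<le>M. ari a (b + j) * ari (b + j) b * ari (k + (a - (b + j))) c)"
      by (rule sum.reindex_bij_witness[of _ "\<lambda>j. b + j" "\<lambda>l. l - b"]) (auto simp: M b)
    also have "\<dots> = (if a \<le> c + b then ari a b * ari k (c + b - a) else 0)"
    proof (cases c)
      case 0
      with k M b show ?thesis by (auto simp: ari_0_right)
    next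
      case (Suc r)
      have "ari a (b + j) * ari (b + j) b * ari (k + (a - (b + j))) c =
          (-1) ^ (M + k' + r + M) * of_nat ((b' + M) choose b') *
          ((-1) ^ j * of_nat (M choose j) * of_nat ((k' + (M - j)) choose r))" if "j \<le> M" for j
      proof -
        \<comment> \<open>This isolates a factor independent of j and leaves the alternating sum
          evaluated above.\<close>
        have "((b' + M) choose (b' + j)) * ((b' + j) choose b') =
            ((b' + M) choose b') * (M choose j)"
          using choose_mult[of b' "b' + j" "b' + M"] that by simp
        then have "(of_nat ((b' + M) choose (b' + j)) * of_nat ((b' + j) choose b') :: rat) =
            of_nat ((b' + M) choose b') * of_nat (M choose j)"
          by (metis of_nat_mult)
        moreover have "(-1::rat) ^ (b' + M + (b' + j)) * (-1) ^ (b' + j + b') * (-1) ^ (k' + (M - j) + r) =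
            (-1) ^ (M + k' + r + M) * (-1) ^ j"
        proof -
          have "even (b' + M + (b' + j) + (b' + j + b') + (k' + (M - j) + r)) =
              even (M + k' + r + M + j)"
            using that by (auto simp: even_diff_nat)
          then show ?thesis
            by (cases "even (M + k' + r + M + j)") (simp_all flip: power_add)
        qed
        moreover have "k + (a - (b + j)) = Suc (k' + (M - j))"
          using that by (simp add: k M b)
        ultimately show ?thesis
          by (simp add: M b Suc ari_Suc_Suc) (simp add: ac_simps)
      qed
      then have "(\<Sum>j\<le>M. ari a (b + j) * ari (b + j) b * ari (k + (a - (b + j))) c) =
         (-1) ^ (M + k' + r + M) * of_nat ((b' + M) choose b') *
          (\<Sum>j\<le>M. (-1) ^ j * of_nat (M choose j) * of_nat ((k' + (M - j)) choose r))"
        by (simp add: sum_distrib_left)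
      also have "\<dots> = (if a \<le> c + b then ari a b * ari k (c + b - a) else 0)"
      proof -
        \<comment> \<open>The boundary case is \<open>M = Suc r\<close>: the condition
          \<open>a \<le> c + b\<close> still holds, but \<open>c + b - a\<close> is 0. Both sides
          vanish there, the right one because \<open>ari k 0\<close> is 0.\<close>
        consider "M \<le> r" | "M = Suc r" | "M > Suc r" by linarith
        then show ?thesis
        proof cases
          case 1
          then obtain d where "r = M + d" by (metis le_Suc_ex)
          then show ?thesis
            unfolding sum_binomial_alternating
            by (simp add: M b k Suc ari_Suc_Suc power_add) 
        next
          case 2
          then show ?thesis
            unfolding sum_binomial_alternating by (simp add: M b k Suc ari_0_right)
        next
          case 3
          then show ?thesis
            unfolding sum_binomial_alternating by (simp add: M b Suc)
        qed
      qed
      finally show ?thesis .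
    qed
    finally show ?thesis .
  qed
qed

subsection \<open>The action of words on sequences\<close>

text \<open>A sequence g stands for a letter v_s with a formal shift: g n plays the role of v_(s+n).  The
  letter v_a acts by the commutator with the shifts of v_a, the shift being transferred to g.\<close>

definition step :: "nat \<Rightarrow> (nat \<Rightarrow> QV) \<Rightarrow> nat \<Rightarrow> QV" where
  "step a g n = (\<Sum>l\<le>a. scale (ari a l) (comm (g (n + (a - l))) (letter l)))"

fun act :: "nat list \<Rightarrow> (nat \<Rightarrow> QV) \<Rightarrow> nat \<Rightarrow> QV" where
  "act [] g = g"
| "act (a # u) g = act u (step a g)"

fun act_word :: "(nat \<Rightarrow> QV) \<Rightarrow> nat \<Rightarrow> word \<Rightarrow> QV" where
  "act_word g n (Word u) = act u g n"

definition actl :: "QV \<Rightarrow> (nat \<Rightarrow> QV) \<Rightarrow> nat \<Rightarrow> QV" where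
  "actl A g n = lin_ext (act_word g n) A"

lemma lin_actl: "lin f \<Longrightarrow> lin (\<lambda>p. actl (f p) g n)"
  unfolding actl_def by (rule lin_lin_ext')

lemmas actl_linear =
  lin_add[OF lin_actl[OF lin_id]] lin_scale[OF lin_actl[OF lin_id]]
  lin_diff[OF lin_actl[OF lin_id]] lin_sum[OF lin_actl[OF lin_id]] lin_0[OF lin_actl[OF lin_id]]

lemma actl_vword: "actl (vword u) g n = act u g n"
  by (simp add: actl_def lin_ext_vword)

lemma actl_fun:
  "actl (vword u) g = act u g"
  "actl (p + q) g = (\<lambda>n. actl p g n + actl q g n)"
  "actl (scale c p) g = (\<lambda>n. scale c (actl p g n))"
  by (simp_all add: fun_eq_iff actl_vword actl_linear)

lemma step_add: "step a (\<lambda>n. g n + h n) = (\<lambda>n. step a g n + step a h n)"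
  by (simp add: fun_eq_iff step_def comm_linear scale_add_right sum.distrib)

lemma step_scale: "step a (\<lambda>n. scale c (g n)) = (\<lambda>n. scale c (step a g n))"
  by (simp add: fun_eq_iff step_def comm_linear scale_sum mult.commute)

lemma act_add: "act u (\<lambda>n. g n + h n) = (\<lambda>n. act u g n + act u h n)"
  by (induction u arbitrary: g h) (simp_all add: step_add)

lemma act_scale: "act u (\<lambda>n. scale c (g n)) = (\<lambda>n. scale c (act u g n))"
  by (induction u arbitrary: g) (simp_all add: step_scale)

lemma act_append: "act (u @ w) g = act w (act u g)"
  by (induction u arbitrary: g) simp_all

text \<open>\<open>step\<close> reaches the sequence only through indices relative to n, so the
  action commutes with translations. An entry at n > 0 of the action on v_s can therefore be read as
  the action on v_(s+n).\<close>

lemma act_shift: "act u (\<lambda>i. g (i + m)) n = act u g (n + m)"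
proof (induction u arbitrary: g n)
  case (Cons a u)
  have "step a (\<lambda>i. g (i + m)) = (\<lambda>i. step a g (i + m))"
    by (simp add: fun_eq_iff step_def ac_simps)
  with Cons show ?case by simp
qed simp

text \<open>The first letter of a word is bracketed first, hence innermost: words act from the
  right.\<close>

lemma actl_mult: "actl (A * B) g n = actl B (actl A g) n"
proof (induction B rule: word_induct)
  case (vword w)
  have "actl (A * vword w) g n = act w (actl A g) n"
    by (induction A arbitrary: n rule: word_induct)
      (simp_all add: actl_fun act_append distrib_right scale_mult_left act_add act_scale
        flip: vword_append)
  then show ?case by (simp add: actl_vword)
qed (simp_all add: distrib_left scale_mult_right actl_linear)

lemma actl_comm: "actl (comm A B) g n = actl B (actl A g) n - actl A (actl B g) n"
  by (simp add: comm_def actl_linear actl_mult)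

subsection \<open>The post-Lie product\<close>

fun tri_letter :: "nat list \<Rightarrow> nat \<Rightarrow> QV" where
  "tri_letter u s =
     (if s = 0 then (if u = [] then letter 0 else 0) else act u (\<lambda>n. letter (s + n)) 0)"

fun tri_list :: "nat list \<Rightarrow> nat list \<Rightarrow> QV" where
  "tri_list u [] = (if u = [] then 1 else 0)"
| "tri_list u (s # w) = unshuffle_sum (\<lambda>p q. tri_letter p s * tri_list q w) u"

fun tri_word :: "word \<Rightarrow> word \<Rightarrow> QV" where
  "tri_word (Word u) (Word w) = tri_list u w"

definition tri :: "QV \<Rightarrow> QV \<Rightarrow> QV" where
  "tri = bilin_ext tri_word"

lemma lin_tri: "lin f \<Longrightarrow> lin (\<lambda>p. tri (f p) y)" "lin f \<Longrightarrow> lin (\<lambda>p. tri y (f p))"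
  unfolding tri_def by (auto intro!: lin_bilin_ext_left lin_bilin_ext_right)

lemmas tri_linear =
  lin_add[OF lin_tri(1)[OF lin_id]] lin_scale[OF lin_tri(1)[OF lin_id]] lin_0[OF lin_tri(1)[OF lin_id]]
  lin_diff[OF lin_tri(1)[OF lin_id]] lin_sum[OF lin_tri(1)[OF lin_id]]
  lin_add[OF lin_tri(2)[OF lin_id]] lin_scale[OF lin_tri(2)[OF lin_id]] lin_0[OF lin_tri(2)[OF lin_id]]
  lin_diff[OF lin_tri(2)[OF lin_id]] lin_sum[OF lin_tri(2)[OF lin_id]]

lemma tri_vword: "tri (vword u) (vword w) = tri_list u w"
  by (simp add: tri_def bilin_ext_vword)

lemma tri_vword_letter: "tri (vword u) (letter s) = tri_letter u s"
proof -
  have "tri (vword u) (letter s) = unshuffle_sum (\<lambda>p q. if q = [] then tri_letter p s else 0) u"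
    unfolding tri_vword tri_list.simps
    by (rule unshuffle_sum_cong) (simp del: tri_letter.simps)
  then show ?thesis by (simp only: unshuffle_sum_Nil_right)
qed

text \<open>The last letter acts outermost, so its bracket is visible from outside, and by
  \<open>act_shift\<close> the shift it causes can be transferred to the index s. This is why the
  induction below removes letters from the right.\<close>

lemma tri_letter_snoc:
  assumes "s > 0"
  shows "tri_letter (w @ [a]) s =
    (\<Sum>l\<le>a. scale (ari a l) (comm (tri_letter w (s + (a - l))) (letter l)))"
proof -
  have "act w (\<lambda>n. letter (s + n)) m = act w (\<lambda>n. letter (s + m + n)) 0" for m
    using act_shift[of w "\<lambda>n. letter (s + n)" m 0] by (simp add: ac_simps)
  with assms show ?thesis by (simp add: act_append step_def)
qed

text \<open>Gives inner sums a range independent of l, so that they can be interchanged with the sum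
  over l.\<close>

lemma sum_ari_extend:
  "l \<le> a \<Longrightarrow> (\<Sum>b\<le>l. scale (ari l b) (F b)) = (\<Sum>b\<le>a. scale (ari l b) (F b))"
  by (rule sum.mono_neutral_left) (auto simp: ari_eq_0)

text \<open>Formal shifts commute with the product by any word; the proof peels off the last letter, with the
  Jacobi identity and \<open>ari_shift\<close>.\<close>

lemma actl_tri_letter:
  "actl (tri_letter w k) g n =
    (\<Sum>l\<le>k. scale (ari k l) (comm (g (n + (k - l))) (tri_letter w l)))"
proof (induction w arbitrary: k g n rule: rev_induct)
  case Nil
  have "tri_letter [] k = letter k" for k by simp
  then show ?case by (simp only: actl_vword act.simps step_def)
next
  case (snoc a w)
  note tri_letter.simps [simp del]
  show ?case
  proof (cases "k = 0")
    case True
    then show ?thesis by (simp add: tri_letter.simps actl_linear comm_linear)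
  next
    case False
    \<comment> \<open>Whatever a letter loses is added to the index of g. That index is therefore n
      plus the initial total \<open>k + a\<close>, minus the final indices b and c, and does not
      depend on the intermediate l.\<close>
    define Z where "Z b c = comm (g (n + k + a - b - c)) (comm (tri_letter w c) (letter b))" for b c
    have expand: "actl (comm (tri_letter w (k + (a - l))) (letter l)) g n =
        (\<Sum>b\<le>a. \<Sum>c\<le>k + a. scale (ari l b * ari (k + (a - l)) c) (Z b c))" if l: "l \<le> a" for l
    proof -
      let ?k = "k + (a - l)"
      have "actl (comm (tri_letter w ?k) (letter l)) g n =
          step l (actl (tri_letter w ?k) g) n - actl (tri_letter w ?k) (step l g) n"
        by (simp add: actl_comm actl_fun)
      also have "step l (actl (tri_letter w ?k) g) n = (\<Sum>b\<le>l. \<Sum>c\<le>?k. scale (ari l b * ari ?k c)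
          (comm (comm (g (n + (l - b) + (?k - c))) (tri_letter w c)) (letter b)))"
        by (simp add: step_def snoc.IH comm_linear scale_sum)
      also have "actl (tri_letter w ?k) (step l g) n = (\<Sum>c\<le>?k. \<Sum>b\<le>l. scale (ari l b * ari ?k c)
          (comm (comm (g (n + (l - b) + (?k - c))) (letter b)) (tri_letter w c)))"
        by (simp add: step_def snoc.IH comm_linear scale_sum ac_simps)
      also have "\<dots> = (\<Sum>b\<le>l. \<Sum>c\<le>?k. scale (ari l b * ari ?k c)
          (comm (comm (g (n + (l - b) + (?k - c))) (letter b)) (tri_letter w c)))"
        by (rule sum.swap)
      also have "(\<Sum>b\<le>l. \<Sum>c\<le>?k. scale (ari l b * ari ?k c)
          (comm (comm (g (n + (l - b) + (?k - c))) (tri_letter w c)) (letter b))) -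
        (\<Sum>b\<le>l. \<Sum>c\<le>?k. scale (ari l b * ari ?k c)
          (comm (comm (g (n + (l - b) + (?k - c))) (letter b)) (tri_letter w c))) =
        (\<Sum>b\<le>l. \<Sum>c\<le>?k. scale (ari l b * ari ?k c) (Z b c))"
        unfolding sum_subtractf[symmetric] scale_diff_right[symmetric] comm_jacobi
      proof (intro sum.cong refl)
        fix b c assume "b \<in> {..l}" "c \<in> {..?k}"
        then have "n + (l - b) + (?k - c) = n + k + a - b - c" using l by auto
        then show "scale (ari l b * ari ?k c)
            (comm (g (n + (l - b) + (?k - c))) (comm (tri_letter w c) (letter b))) =
          scale (ari l b * ari ?k c) (Z b c)" by (simp add: Z_def)
      qed
      also have "\<dots> = (\<Sum>b\<le>l. scale (ari l b) (\<Sum>c\<le>?k. scale (ari ?k c) (Z b c)))"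
        by (simp add: scale_sum)
      also have "\<dots> = (\<Sum>b\<le>a. scale (ari l b) (\<Sum>c\<le>k + a. scale (ari ?k c) (Z b c)))"
        using l by (simp only: sum_ari_extend[OF l] sum_ari_extend[of ?k "k + a"] add_left_mono diff_le_self)
      finally show ?thesis by (simp add: scale_sum)
    qed
    have "actl (tri_letter (w @ [a]) k) g n =
        (\<Sum>l\<le>a. scale (ari a l) (actl (comm (tri_letter w (k + (a - l))) (letter l)) g n))"
      using False by (simp add: tri_letter_snoc actl_linear)
    also have "\<dots> = (\<Sum>l\<le>a. \<Sum>b\<le>a. \<Sum>c\<le>k + a.
        scale (ari a l * ari l b * ari (k + (a - l)) c) (Z b c))"
      by (intro sum.cong refl) (simp only: atMost_iff expand scale_sum scale_scale mult.assoc)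
    also have "\<dots> = (\<Sum>b\<le>a. \<Sum>l\<le>a. \<Sum>c\<le>k + a.
        scale (ari a l * ari l b * ari (k + (a - l)) c) (Z b c))"
      by (rule sum.swap)
    also have "\<dots> = (\<Sum>b\<le>a. \<Sum>c\<le>k + a. \<Sum>l\<le>a.
        scale (ari a l * ari l b * ari (k + (a - l)) c) (Z b c))"
      by (intro sum.cong refl sum.swap)
    also have "\<dots> = (\<Sum>b\<le>a. \<Sum>c\<le>k + a.
        scale (if a \<le> c + b then ari a b * ari k (c + b - a) else 0) (Z b c))"
      using False
      by (intro sum.cong refl) (simp only: atMost_iff neq0_conv ari_shift flip: sum_scale)
    \<comment> \<open>With \<open>c = l + (a - b)\<close> the shifts have changed order: a is now
      lowered to b within the product on v_l, which is the form of
      \<open>tri_letter_snoc\<close>.\<close>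
    also have "\<dots> = (\<Sum>b\<le>a. \<Sum>l\<le>k. scale (ari a b * ari k l) (Z b (l + (a - b))))"
    proof (rule sum.cong[OF refl])
      fix b assume "b \<in> {..a}"
      then have b: "b \<le> a" by simp
      have "(\<Sum>c\<le>k + a. scale (if a \<le> c + b then ari a b * ari k (c + b - a) else 0) (Z b c)) =
          (\<Sum>c\<in>{a - b..k + (a - b)}. scale (if a \<le> c + b then ari a b * ari k (c + b - a) else 0) (Z b c))"
        by (rule sum.mono_neutral_right) (use b in \<open>auto simp: ari_eq_0\<close>)
      also have "\<dots> = (\<Sum>l\<le>k. scale (ari a b * ari k l) (Z b (l + (a - b))))"
        by (rule sum.reindex_bij_witness[of _ "\<lambda>l. l + (a - b)" "\<lambda>c. c - (a - b)"]) (use b in auto)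
      finally show "(\<Sum>c\<le>k + a. scale (if a \<le> c + b then ari a b * ari k (c + b - a) else 0) (Z b c)) =
          (\<Sum>l\<le>k. scale (ari a b * ari k l) (Z b (l + (a - b))))" .
    qed
    also have "\<dots> = (\<Sum>l\<le>k. \<Sum>b\<le>a. scale (ari a b * ari k l) (Z b (l + (a - b))))"
      by (rule sum.swap)
    also have "\<dots> = (\<Sum>l\<le>k. scale (ari k l) (comm (g (n + (k - l))) (tri_letter (w @ [a]) l)))"
    proof (intro sum.cong refl)
      fix l assume "l \<in> {..k}"
      then have l: "l \<le> k" by simp
      show "(\<Sum>b\<le>a. scale (ari a b * ari k l) (Z b (l + (a - b)))) =
          scale (ari k l) (comm (g (n + (k - l))) (tri_letter (w @ [a]) l))"
      proof (cases "l = 0")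
        \<comment> \<open>\<open>tri_letter_snoc\<close> requires a positive index. At l = 0 the
          coefficient \<open>ari k 0\<close> vanishes instead, as k is positive.\<close>
        case True
        with False show ?thesis by (simp add: ari_0_right)
      next
        case False
        have "n + k + a - b - (l + (a - b)) = n + (k - l)" if "b \<le> a" for b
          using that l by simp
        with False show ?thesis
          by (simp add: Z_def tri_letter_snoc comm_linear scale_sum mult.commute)
      qed
    qed
    finally show ?thesis .
  qed
qed

lemma actl_tri:
  "actl (tri x (letter k)) g n =
    (\<Sum>l\<le>k. scale (ari k l) (comm (g (n + (k - l))) (tri x (letter l))))"
  by (induction x rule: word_induct)
    (simp_all add: tri_vword_letter actl_tri_letter tri_linear actl_linear comm_linear
      scale_add_right sum.distrib scale_sum mult.commute del: tri_letter.simps)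

text \<open>Coassociativity carries the splitting from \<open>s # (b @ c)\<close> over to
  \<open>(s # b) @ c\<close>.\<close>

lemma tri_list_append:
  "tri_list u (b @ c) = unshuffle_sum (\<lambda>p q. tri_list p b * tri_list q c) u"
proof (induction b arbitrary: u)
  case Nil
  have "unshuffle_sum (\<lambda>p q. tri_list p [] * tri_list q c) u =
      unshuffle_sum (\<lambda>p q. if p = [] then tri_list q c else 0) u"
    by (rule unshuffle_sum_cong) simp
  then show ?case by (simp only: unshuffle_sum_Nil_left append_Nil)
next
  case (Cons s b)
  have "tri_list u ((s # b) @ c) =
      unshuffle_sum (\<lambda>p q. unshuffle_sum (\<lambda>r t. tri_letter p s * tri_list r b * tri_list t c) q) u"
    by (simp add: Cons unshuffle_sum_hom[of "\<lambda>x. _ * x", OF distrib_left] mult.assoc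
        del: tri_letter.simps)
  also have "\<dots> = unshuffle_sum (\<lambda>p q. unshuffle_sum (\<lambda>r t. tri_letter r s * tri_list t b * tri_list q c) p) u"
    by (rule unshuffle_sum_assoc[symmetric])
  also have "\<dots> = unshuffle_sum (\<lambda>p q. tri_list p (s # b) * tri_list q c) u"
    by (simp add: unshuffle_sum_hom[of "\<lambda>x. x * _", OF distrib_right] del: tri_letter.simps)
  finally show ?case .
qed

lemma tri_mult: "tri A (B * C) = sweedler (\<lambda>a b. tri a B * tri b C) A"
proof (induction B rule: word_induct)
  case (vword b)
  show ?case
  proof (induction C rule: word_induct)
    case (vword c)
    show ?case
      by (induction A rule: word_induct)
        (simp_all add: sweedler_vword tri_vword tri_list_append tri_linear sweedler_linear
          flip: vword_append)
  qed (simp_all add: distrib_left scale_mult_right tri_linear sweedler_fun_add sweedler_fun_scale)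
qed (simp_all add: distrib_right scale_mult_left tri_linear sweedler_fun_add sweedler_fun_scale)

lemma tri_one_left [simp]: "tri 1 A = A"
proof (induction A rule: word_induct)
  case (vword w)
  have "tri_list [] w = vword w"
    by (induction w) (simp_all add: vword_Nil actl_vword, metis vword_Cons)
  then show ?case by (simp add: tri_vword flip: vword_Nil)
qed (simp_all add: tri_linear)

lemma tri_one_right: "tri A 1 = scale (cf A []) 1"
  by (induction A rule: word_induct)
    (auto simp: tri_vword cf_vword lookup_add lookup_scale tri_linear scale_add_left
      simp flip: vword_Nil)

section \<open>Lie elements act as derivations\<close>

lemma bilin_tri_mult: "bilin (\<lambda>a b. tri a B * tri b C)"
  unfolding bilin_def by (auto intro!: lin_mult_left lin_mult_right lin_tri)

lemma tri_Lie_one: "x \<in> Lie \<Longrightarrow> tri x 1 = 0"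
  by (simp add: tri_one_right cf_Lie_Nil)

lemma tri_Lie_mult: "x \<in> Lie \<Longrightarrow> tri x (B * C) = tri x B * C + B * tri x C"
  by (simp add: tri_mult sweedler_Lie[OF _ bilin_tri_mult])

lemma tri_Lie_comm: "x \<in> Lie \<Longrightarrow> tri x (comm B C) = comm (tri x B) C + comm B (tri x C)"
  by (simp add: comm_def tri_linear tri_Lie_mult)

lemma tri_letter_actl: "s > 0 \<Longrightarrow> tri A (letter s) = actl A (\<lambda>n. letter (s + n)) 0"
  by (induction A rule: word_induct)
    (simp_all add: tri_vword_letter actl_vword tri_linear actl_linear)

lemma tri_letter_zero: "tri A (letter 0) = scale (cf A []) (letter 0)"
  by (induction A rule: word_induct)
    (auto simp: tri_vword_letter cf_vword tri_linear lookup_add lookup_scale scale_add_left)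

lemma cf_comm_Nil: "cf (comm x y) [] = 0"
  by (simp add: comm_def lookup_minus cf_mult_Nil)

text \<open>A nonempty word turns a letter into a sum of commutators (or 0), and these have no
  constant term. In the coproduct formula this excludes empty blocks.\<close>

lemma cf_tri_letter_Nil: "cf (tri A (letter s)) [] = 0"
proof (cases "s = 0")
  case True
  then show ?thesis by (simp add: tri_letter_zero lookup_scale cf_vword)
next
  case False
  show ?thesis
  proof (induction A rule: word_induct)
    case (vword w)
    show ?case
    proof (cases w rule: rev_cases)
      case Nil
      then show ?thesis by (simp add: vword_Nil) (simp add: cf_vword)
    next
      case (snoc w' a)
      with False show ?thesis
        by (simp add: tri_vword_letter tri_letter_snoc lookup_sum lookup_scale cf_comm_Nil
            del: tri_letter.simps)
    qed
  qed (simp_all add: tri_linear lookup_add lookup_scale)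
qed

lemma cf_tri_Lie_Nil: "x \<in> Lie \<Longrightarrow> cf (tri x A) [] = 0"
proof (induction A rule: word_induct)
  case (vword w)
  then show ?case
  proof (induction w)
    case (Cons a w)
    then show ?case
      by (subst vword_Cons) (simp add: tri_Lie_mult lookup_add cf_mult_Nil cf_tri_letter_Nil)
  qed (simp add: vword_Nil tri_Lie_one)
qed (simp_all add: tri_linear lookup_add lookup_scale)

text \<open>By the Leibniz rule x differentiates either g or the shifted letters of v_a. The latter
  terms add up to the action of \<open>tri x (letter a)\<close>, which is exactly the content of
  \<open>actl_tri\<close>.\<close>

lemma tri_step:
  assumes "x \<in> Lie"
  shows "tri x (step a g n) = step a (\<lambda>n. tri x (g n)) n + actl (tri x (letter a)) g n"
  by (simp add: step_def actl_tri tri_linear tri_Lie_comm[OF assms] scale_add_right sum.distrib)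

lemma tri_actl:
  assumes "x \<in> Lie"
  shows "tri x (actl A g n) = actl A (\<lambda>n. tri x (g n)) n + actl (tri x A) g n"
proof (induction A rule: word_induct)
  case (vword u)
  have "tri x (act u g n) = act u (\<lambda>n. tri x (g n)) n + actl (tri x (vword u)) g n"
  proof (induction u arbitrary: g n)
    case Nil
    show ?case by (simp add: vword_Nil tri_Lie_one[OF assms] actl_linear)
  next
    case (Cons a u)
    have "tri x (vword (a # u)) = tri x (letter a) * vword u + letter a * tri x (vword u)"
      by (subst vword_Cons) (rule tri_Lie_mult[OF assms])
    then have "actl (tri x (vword (a # u))) g n =
        act u (actl (tri x (letter a)) g) n + actl (tri x (vword u)) (step a g) n"
      by (simp add: actl_linear actl_mult actl_fun)
    then show ?case
      by (simp add: Cons tri_step[OF assms] act_add)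
  qed
  then show ?case by (simp add: actl_vword)
qed (simp_all add: actl_linear tri_linear scale_add_right)

lemma actl_shift: "actl A (\<lambda>i. g (i + m)) n = actl A g (n + m)"
  by (induction A rule: word_induct) (simp_all add: actl_vword act_shift actl_linear)

text \<open>In \<open>x * A\<close> the element x acts on the letter before A does, in
  \<open>tri x (tri A (letter s))\<close> after it. Moving x past A with \<open>tri_actl\<close>
  costs precisely the subtracted term. For s = 0 all three terms vanish, since x and
  \<open>tri x A\<close> have no constant term.\<close>

lemma tri_Lie_left_mult_letter:
  assumes "x \<in> Lie"
  shows "tri (x * A) (letter s) = tri x (tri A (letter s)) - tri (tri x A) (letter s)"
proof (cases "s = 0")
  case True
  then show ?thesis
    by (simp add: tri_letter_zero cf_mult_Nil cf_Lie_Nil[OF assms] tri_linear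
        cf_tri_Lie_Nil[OF assms])
next
  case False
  let ?V = "\<lambda>n. letter (s + n)"
  have "actl x ?V n = tri x (letter (s + n))" for n
    using actl_shift[of x ?V n 0] False by (simp add: tri_letter_actl ac_simps)
  then have "actl x ?V = (\<lambda>n. tri x (letter (s + n)))" by auto
  with False show ?thesis
    by (simp add: tri_letter_actl[of s] actl_mult tri_actl[OF assms])
qed

text \<open>A derivation that sends letters to primitive elements is a coderivation. The hypothesis
  on letters is supplied later by \<open>tri_in_Lie\<close>, which rests on the comparison with the
  free magma.\<close>

lemma sweedler_tri_Lie:
  assumes x: "x \<in> Lie" and letters: "\<And>s. tri x (letter s) \<in> Lie" and "bilin f"
  shows "sweedler f (tri x A) = sweedler (\<lambda>a b. f (tri x a) b + f a (tri x b)) A"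
  using \<open>bilin f\<close>
proof (induction A arbitrary: f rule: word_induct)
  case (vword w)
  then show ?case
  proof (induction w arbitrary: f)
    case Nil
    then show ?case
      by (simp add: vword_Nil tri_Lie_one[OF x] sweedler_linear sweedler_one)
        (simp add: bilin_def lin_0 lin_0[of "\<lambda>p. f p _"])
  next
    case (Cons a w)
    let ?z = "tri x (letter a)"
    have bil: "bilin (\<lambda>p q. f (z * p) q + f p (z * q))" for z
      using Cons.prems by (auto simp: bilin_def lin_def distrib_left scale_mult_right scale_add_right)
    have add: "f (p + q) r = f p r + f q r" "f r (p + q) = f r p + f r q" for p q r
      using Cons.prems by (simp_all add: bilin_def lin_def)
    have "sweedler f (tri x (vword (a # w))) =
        sweedler f (?z * vword w) + sweedler f (letter a * tri x (vword w))"
      by (subst vword_Cons) (simp add: tri_Lie_mult[OF x] sweedler_linear)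
    also have "\<dots> = sweedler (\<lambda>p q. f (?z * p) q + f p (?z * q)) (vword w) +
        sweedler (\<lambda>p q. (f (letter a * tri x p) q + f (tri x p) (letter a * q)) +
          (f (letter a * p) (tri x q) + f p (letter a * tri x q))) (vword w)"
      by (simp only: sweedler_Lie_mult[OF letters Cons.prems] sweedler_letter_mult Cons.IH[OF bil])
    also have "\<dots> = sweedler (\<lambda>a b. f (tri x a) b + f a (tri x b)) (letter a * vword w)"
      by (simp add: sweedler_letter_mult tri_Lie_mult[OF x] add ac_simps flip: sweedler_fun_add)
    finally show ?case by (simp only: vword_Cons[of a w])
  qed
qed (simp_all add: tri_linear sweedler_linear)

text \<open>Passing from letters to words, the three terms split over a product in the same way: the
  first because x is primitive, the second by the Leibniz rule, the third because x acts as a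
  coderivation.\<close>

lemma tri_Lie_left_mult:
  assumes x: "x \<in> Lie" and letters: "\<And>s. tri x (letter s) \<in> Lie"
  shows "tri (x * A) y = tri x (tri A y) - tri (tri x A) y"
proof (induction y arbitrary: A rule: word_induct)
  case (vword w)
  show ?case
  proof (induction w arbitrary: A)
    case Nil
    show ?case
      by (simp add: vword_Nil tri_one_right cf_mult_Nil cf_Lie_Nil[OF x] cf_tri_Lie_Nil[OF x]
          tri_linear)
  next
    case (Cons s w)
    let ?f = "\<lambda>a b. tri a (letter s) * tri b (vword w)"
    have "tri (x * A) (letter s * vword w) =
        sweedler (\<lambda>a b. tri (x * a) (letter s) * tri b (vword w) +
          tri a (letter s) * tri (x * b) (vword w)) A"
      by (simp add: tri_mult sweedler_Lie_mult[OF x bilin_tri_mult])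
    also have "\<dots> = sweedler (\<lambda>a b. tri x (?f a b) -
        (tri (tri x a) (letter s) * tri b (vword w) + tri a (letter s) * tri (tri x b) (vword w))) A"
      by (simp add: tri_Lie_left_mult_letter[OF x] Cons tri_Lie_mult[OF x] algebra_simps)
    also have "\<dots> = tri x (tri A (letter s * vword w)) - tri (tri x A) (letter s * vword w)"
      by (simp add: sweedler_fun_diff tri_mult sweedler_tri_Lie[OF x letters bilin_tri_mult]
          sweedler_comp[OF lin_tri(2)[OF lin_id]])
    finally show ?case by (simp only: vword_Cons[of s w])
  qed
qed (simp_all add: tri_linear scale_diff_right)

subsection \<open>Comparison with the free magma\<close>

abbreviation below :: "nat list \<Rightarrow> nat list set" where
  "below u \<equiv> {ls. list_all2 (\<le>) ls u}"

lemma sum_below_append: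
  "(\<Sum>ls\<in>below (u @ w). F ls) = (\<Sum>p\<in>below u. \<Sum>q\<in>below w. F (p @ q))"
  unfolding sum.cartesian_product
  by (rule sum.reindex_bij_witness[of _ "\<lambda>(p, q). p @ q"
        "\<lambda>ls. (take (length u) ls, drop (length u) ls)"])
    (auto simp: list_all2_append2 list_all2_lengthD, blast dest: list_all2_lengthD)

lemma sum_below_singleton: "(\<Sum>ls\<in>below [k]. F ls) = (\<Sum>l\<le>k. F [l])"
  by (rule sum.reindex_bij_witness[of _ "\<lambda>l. [l]" hd]) (auto simp: list_all2_Cons2)

lemma below_sum_list_le: "ls \<in> below u \<Longrightarrow> sum_list ls \<le> sum_list u"
  by simp (induction ls u rule: list_all2_induct; simp)

text \<open>A commutator acts by the commutator of two actions. Shifts of the two halves are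
  independent and their multiplicities multiply, so the Jacobi identity reassembles the bracketing
  with its leaves relabelled.\<close>

lemma actl_lie_proj:
  "actl (lie_proj_basis t) g n = (\<Sum>ls\<in>below (leaves t). scale (ari_mult (leaves t) ls)
     (comm (g (n + (sum_list (leaves t) - sum_list ls))) (lie_proj_basis (relabel t ls))))"
proof (induction t arbitrary: g n)
  case (Gen i)
  show ?case
    by (simp add: sum_below_singleton actl_vword step_def ari_mult_Cons)
next
  case (Star t1 t2)
  let ?u = "leaves t1" and ?w = "leaves t2"
  let ?c = "\<lambda>p q. ari_mult ?u p * ari_mult ?w q"
  let ?N = "\<lambda>p q. n + (sum_list ?u - sum_list p) + (sum_list ?w - sum_list q)"
  let ?x = "\<lambda>p. lie_proj_basis (relabel t1 p)" and ?y = "\<lambda>q. lie_proj_basis (relabel t2 q)"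
  have "actl (lie_proj_basis (Star t1 t2)) g n =
      actl (lie_proj_basis t2) (actl (lie_proj_basis t1) g) n -
      actl (lie_proj_basis t1) (actl (lie_proj_basis t2) g) n"
    by (simp add: actl_comm flip: comm_def)
  also have "actl (lie_proj_basis t2) (actl (lie_proj_basis t1) g) n =
      (\<Sum>q\<in>below ?w. \<Sum>p\<in>below ?u. scale (?c p q) (comm (comm (g (?N p q)) (?x p)) (?y q)))"
    by (simp add: Star comm_linear scale_sum ac_simps)
  also have "\<dots> = (\<Sum>p\<in>below ?u. \<Sum>q\<in>below ?w. scale (?c p q) (comm (comm (g (?N p q)) (?x p)) (?y q)))"
    by (rule sum.swap)
  also have "actl (lie_proj_basis t1) (actl (lie_proj_basis t2) g) n =
      (\<Sum>p\<in>below ?u. \<Sum>q\<in>below ?w. scale (?c p q) (comm (comm (g (?N p q)) (?y q)) (?x p)))"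
    by (simp add: Star comm_linear scale_sum ac_simps)
  also have "(\<Sum>p\<in>below ?u. \<Sum>q\<in>below ?w. scale (?c p q) (comm (comm (g (?N p q)) (?x p)) (?y q))) -
        (\<Sum>p\<in>below ?u. \<Sum>q\<in>below ?w. scale (?c p q) (comm (comm (g (?N p q)) (?y q)) (?x p))) =
      (\<Sum>p\<in>below ?u. \<Sum>q\<in>below ?w. scale (?c p q) (comm (g (?N p q)) (comm (?x p) (?y q))))"
    by (simp only: comm_jacobi flip: sum_subtractf scale_diff_right)
  also have "\<dots> = (\<Sum>p\<in>below ?u. \<Sum>q\<in>below ?w. scale (ari_mult (?u @ ?w) (p @ q))
      (comm (g (n + (sum_list (?u @ ?w) - sum_list (p @ q))))
        (lie_proj_basis (relabel (Star t1 t2) (p @ q)))))"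
  proof (intro sum.cong refl)
    fix p q assume pq: "p \<in> below ?u" "q \<in> below ?w"
    then have "?N p q = n + (sum_list (?u @ ?w) - sum_list (p @ q))"
      using below_sum_list_le[OF pq(1)] below_sum_list_le[OF pq(2)] by simp
    moreover have "length p = length ?u"
      using pq(1) by (simp add: list_all2_lengthD)
    ultimately show "scale (?c p q) (comm (g (?N p q)) (comm (?x p) (?y q))) =
        scale (ari_mult (?u @ ?w) (p @ q)) (comm (g (n + (sum_list (?u @ ?w) - sum_list (p @ q))))
          (lie_proj_basis (relabel (Star t1 t2) (p @ q))))"
      by (simp only: ari_mult_append relabel.simps lie_proj_basis.simps comm_def[of "?x p" "?y q"])
        (simp add: comm_def)
  qed
  also have "\<dots> = (\<Sum>ls\<in>below (?u @ ?w). scale (ari_mult (?u @ ?w) ls)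
     (comm (g (n + (sum_list (?u @ ?w) - sum_list ls))) (lie_proj_basis (relabel (Star t1 t2) ls))))"
    by (rule sum_below_append[symmetric])
  finally show ?case by (simp only: leaves.simps)
qed

lemma lie_proj_star: "lie_proj (star p q) = comm (lie_proj p) (lie_proj q)"
proof (rule bilin_eqI[of "\<lambda>p q. lie_proj (star p q)" "\<lambda>p q. comm (lie_proj p) (lie_proj q)"])
  show "bilin (\<lambda>p q. lie_proj (star p q))"
    unfolding bilin_def star_def
    by (auto intro!: lin_lie_proj lin_bilin_ext_left lin_bilin_ext_right)
  show "bilin (\<lambda>p q. comm (lie_proj p) (lie_proj q))"
    unfolding bilin_def by (auto intro!: lin_lie_proj lin_comm)
qed (simp add: star_def lie_proj_single comm_def)

lemma tri_lie_proj_basis: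
  "tri (lie_proj_basis t) (lie_proj_basis s) = lie_proj (magma_tri_basis t s)"
proof (induction s)
  case (Gen s)
  show ?case
  proof (cases "s = 0")
    case True
    then show ?thesis
      by (simp add: tri_letter_zero cf_Lie_Nil[OF lie_proj_basis_in_Lie] lie_proj_linear)
  next
    case False
    have "s + sum_list (leaves t) - sum_list ls = s + (sum_list (leaves t) - sum_list ls)"
      if "ls \<in> below (leaves t)" for ls
      using below_sum_list_le[OF that] by simp
    then show ?thesis
      using False
      by (simp add: tri_letter_actl actl_lie_proj lie_proj_linear lie_proj_single)
        (simp add: comm_def)
  qed
next
  case (Star s1 s2)
  then show ?case
    by (simp add: tri_Lie_comm[OF lie_proj_basis_in_Lie] lie_proj_linear lie_proj_star lie_proj_single
        flip: comm_def)
qed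

text \<open>In particular \<open>magma_tri\<close> descends: the right side depends on x and y only
  through their images in the free Lie algebra.\<close>

lemma tri_lie_proj: "tri (lie_proj x) (lie_proj y) = lie_proj (magma_tri x y)"
proof (rule bilin_eqI[of "\<lambda>x y. tri (lie_proj x) (lie_proj y)" "\<lambda>x y. lie_proj (magma_tri x y)"])
  show "bilin (\<lambda>x y. lie_proj (magma_tri x y))"
    unfolding bilin_def magma_tri_def
    by (auto intro!: lin_lie_proj lin_bilin_ext_left lin_bilin_ext_right)
  show "bilin (\<lambda>x y. tri (lie_proj x) (lie_proj y))"
    unfolding bilin_def by (auto intro!: lin_lie_proj lin_tri)
qed (simp add: magma_tri_def lie_proj_single tri_lie_proj_basis)

lemma tri_in_Lie: "x \<in> Lie \<Longrightarrow> y \<in> Lie \<Longrightarrow> tri x y \<in> Lie"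
  by (auto simp: Lie_def tri_lie_proj)

lemma is_post_lie_ext_tri: "is_post_lie_ext tri"
  unfolding is_post_lie_ext_def is_bilinear_iff
  using tri_Lie_left_mult tri_in_Lie[OF _ letter_in_Lie]
  by (auto simp: tri_lie_proj tri_Lie_one tri_mult bilin_def lin_tri)

subsection \<open>Uniqueness of the post-Lie extension\<close>

inductive lie_prod :: "nat \<Rightarrow> QV \<Rightarrow> bool" where
  zero: "lie_prod n 0"
| one: "lie_prod 0 1"
| mult: "x \<in> Lie \<Longrightarrow> lie_prod n A \<Longrightarrow> lie_prod (Suc n) (x * A)"
| add: "lie_prod n A \<Longrightarrow> lie_prod n B \<Longrightarrow> lie_prod n (A + B)"

lemma lie_prod_tri:
  assumes "x \<in> Lie"
  shows "lie_prod n A \<Longrightarrow> lie_prod n (tri x A)"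
  by (induction rule: lie_prod.induct)
    (simp_all add: tri_linear tri_Lie_one tri_Lie_mult assms lie_prod.intros tri_in_Lie)

lemma lie_prod_vword: "lie_prod (length w) (vword w)"
proof (induction w)
  case (Cons a w)
  then show ?case by (subst vword_Cons) (simp add: lie_prod.mult letter_in_Lie)
qed (simp add: vword_Nil lie_prod.one)

lemma is_post_lie_extD:
  assumes "is_post_lie_ext T"
  shows "bilin T"
    and "T (lie_proj x) (lie_proj y) = lie_proj (magma_tri x y)"
    and "z \<in> Lie \<Longrightarrow> T z 1 = 0"
    and "T 1 A = A"
    and "z \<in> Lie \<Longrightarrow> y' \<in> Lie \<Longrightarrow> T (z * A) y' = T z (T A y') - T (T z A) y'"
    and "T A (B * C) = sweedler (\<lambda>A1 A2. T A1 B * T A2 C) A"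
  using assms unfolding is_post_lie_ext_def is_bilinear_iff by blast+

text \<open>The axiom for x A acts by T x A, which has the same length as A as a word but fewer factors
  than x A as a product of Lie elements: so the induction is over the number of Lie factors.\<close>

lemma is_post_lie_ext_unique:
  assumes T: "is_post_lie_ext T"
  shows "T = tri"
proof -
  note ax = is_post_lie_extD[OF T]
  have lin: "lin (T p)" "lin (\<lambda>p. T p q)" for p q
    using bilin_lin[OF ax(1)] .
  have bil: "bilin (\<lambda>a b. T a B * T b C)" for B C
    unfolding bilin_def by (auto intro!: lin_mult_left lin_mult_right lin)
  have Lie_Lie: "T x y = tri x y" if "x \<in> Lie" "y \<in> Lie" for x y
    using that by (auto simp: Lie_def ax(2) tri_lie_proj)
  have Lie_left: "T x A = tri x A" if x: "x \<in> Lie" for x A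
  proof (induction A rule: word_induct)
    case (vword w)
    show ?case
    proof (induction w)
      case Nil
      show ?case using ax(3)[OF x] tri_Lie_one[OF x] by (simp add: vword_Nil)
    next
      case (Cons s w)
      have "T x (letter s * vword w) = T x (letter s) * T 1 (vword w) + T 1 (letter s) * T x (vword w)"
        using sweedler_Lie[OF x bil] by (simp add: ax(6))
      then have "T x (letter s * vword w) = tri x (letter s * vword w)"
        by (simp add: ax(4) Cons Lie_Lie[OF x letter_in_Lie] tri_Lie_mult[OF x])
      then show ?case by (simp only: vword_Cons[of s w])
    qed
  qed (simp_all add: lin_add[OF lin(1)] lin_scale[OF lin(1)] tri_linear)
  have lie_prod_letter: "T A (letter s) = tri A (letter s)" if "lie_prod n A" for n A s
    using that
  proof (induction n arbitrary: A rule: less_induct)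
    case (less n)
    from less.prems less.IH show ?case
    \<comment> \<open>Rule induction on \<open>x * A\<close> leads to A but not to
      \<open>tri x A\<close>; the latter is reached through the outer induction on n.\<close>
    proof (induction rule: lie_prod.induct)
      case zero
      then show ?case by (simp add: lin_0[OF lin(2)] tri_linear)
    next
      case one
      then show ?case by (simp add: ax(4))
    next
      case (mult x n A)
      then have "T A (letter s) = tri A (letter s)"
        and "T (tri x A) (letter s) = tri (tri x A) (letter s)"
        using lie_prod_tri by blast+
      with mult show ?case
        by (simp add: ax(5) letter_in_Lie Lie_left tri_Lie_left_mult_letter)
    next
      case (add n A B)
      then show ?case by (simp add: lin_add[OF lin(2)] tri_linear)
    qed
  qed
  have letters: "T A (letter s) = tri A (letter s)" for A s
    by (induction A rule: word_induct)
      (simp_all add: lin_add[OF lin(2)] lin_scale[OF lin(2)] tri_linear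
        lie_prod_letter[OF lie_prod_vword])
  \<comment> \<open>The axioms fix \<open>T x 1\<close> only for Lie elements x.  For general A the map \<open>A \<mapsto> T A 1\<close> is idempotent
    for convolution and 1 at the empty word, hence 0 on all other words.\<close>
  have "T (vword w) 1 = 0" if "w \<noteq> []" for w
    using that
  proof (induction w rule: length_induct)
    case (1 w)
    let ?e = "\<lambda>u. T (vword u) 1"
    have "?e w = unshuffle_sum (\<lambda>p q. ?e p * ?e q) w"
      using ax(6)[of "vword w" 1 1] by (simp add: sweedler_vword)
    also have "\<dots> = unshuffle_sum (\<lambda>p q. (if p = [] then ?e q else 0) + (if q = [] then ?e p else 0)) w"
    proof (rule unshuffle_sum_cong)
      fix p q :: "nat list" assume len: "length p + length q = length w"
      have "?e p = 0" if "p \<noteq> []" "q \<noteq> []"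
      proof -
        from that len have "length p < length w" by (cases q) auto
        with that 1 show ?thesis by blast
      qed
      then show "?e p * ?e q = (if p = [] then ?e q else 0) + (if q = [] then ?e p else 0)"
        using len 1 by (auto simp: vword_Nil ax(4))
    qed
    also have "\<dots> = ?e w + ?e w"
      by (simp only: unshuffle_sum_add unshuffle_sum_Nil_left unshuffle_sum_Nil_right)
    finally show ?case by simp
  qed
  then have "T (vword w) 1 = tri (vword w) 1" for w
    by (cases "w = []") (simp_all add: tri_one_right cf_vword cf_one vword_Nil ax(4))
  then have one: "T A 1 = tri A 1" for A
    by (induction A rule: word_induct)
      (simp_all add: lin_add[OF lin(2)] lin_scale[OF lin(2)] tri_linear)
  have "T A B = tri A B" for A B
  proof (induction B arbitrary: A rule: word_induct)
    case (vword w)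
    show ?case
    proof (induction w arbitrary: A)
      case Nil
      show ?case by (simp add: vword_Nil one)
    next
      case (Cons s w)
      have "T A (letter s * vword w) = tri A (letter s * vword w)"
        by (simp only: ax(6) tri_mult letters Cons)
      then show ?case by (simp only: vword_Cons[of s w])
    qed
  qed (simp_all add: lin_add[OF lin(1)] lin_scale[OF lin(1)] tri_linear)
  then show ?thesis by blast
qed

lemma tri_a_eq: "tri_a = tri"
  unfolding tri_a_def
  using is_post_lie_ext_tri is_post_lie_ext_unique by (rule the_equality)

subsection \<open>Coefficients of the post-Lie product on letters\<close>

text \<open>Each bracket puts its letter to the right of g, or to the left with a minus sign.
  Letters on the left pile up in reverse order, which is the antipode; those on the right keep their
  order.\<close>

lemma act_expansion:
  "act u g n = unshuffle_sum (\<lambda>a b. \<Sum>p\<in>below a. \<Sum>q\<in>below b.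
     scale ((- 1) ^ length a * ari_mult a p * ari_mult b q)
       (vword (rev p) * g (n + (sum_list a - sum_list p) + (sum_list b - sum_list q)) * vword q)) u"
proof (induction u arbitrary: g n)
  case Nil
  show ?case by (simp add: vword_Nil)
next
  case (Cons k u)
  let ?N = "\<lambda>a b p q. n + (sum_list a - sum_list p) + (sum_list b - sum_list q)"
  let ?F = "\<lambda>a b. \<Sum>p\<in>below a. \<Sum>q\<in>below b. scale ((- 1) ^ length a * ari_mult a p * ari_mult b q)
       (vword (rev p) * g (?N a b p q) * vword q)"
  have "act (k # u) g n = unshuffle_sum (\<lambda>a b. \<Sum>p\<in>below a. \<Sum>q\<in>below b.
     scale ((- 1) ^ length a * ari_mult a p * ari_mult b q)
       (vword (rev p) * step k g (?N a b p q) * vword q)) u"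
    by (simp add: Cons)
  also have "\<dots> = unshuffle_sum (\<lambda>a b. ?F (k # a) b + ?F a (k # b)) u"
  proof (rule unshuffle_sum_cong)
    fix a b :: "nat list"
    have left: "?F (k # a) b = (\<Sum>p\<in>below a. \<Sum>q\<in>below b. \<Sum>l\<le>k.
        scale ((- 1) ^ length a * ari_mult a p * ari_mult b q)
          (scale (- ari k l) (vword (rev p) * (letter l * g (?N a b p q + (k - l))) * vword q)))"
    proof -
      have "?F (k # a) b = (\<Sum>l\<le>k. \<Sum>p\<in>below a. \<Sum>q\<in>below b.
          scale ((- 1) ^ length (k # a) * ari_mult (k # a) (l # p) * ari_mult b q)
            (vword (rev (l # p)) * g (?N (k # a) b (l # p) q) * vword q))"
        using sum_below_append[of _ "[k]" a] by (simp only: sum_below_singleton append.simps)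
      also have "\<dots> = (\<Sum>l\<le>k. \<Sum>p\<in>below a. \<Sum>q\<in>below b.
        scale ((- 1) ^ length a * ari_mult a p * ari_mult b q)
          (scale (- ari k l) (vword (rev p) * (letter l * g (?N a b p q + (k - l))) * vword q)))"
      proof (intro sum.cong refl)
        fix l p q assume "l \<in> {..k}" "p \<in> below a"
        then have "?N (k # a) b (l # p) q = ?N a b p q + (k - l)"
          using below_sum_list_le[of p a] by simp
        then show "scale ((- 1) ^ length (k # a) * ari_mult (k # a) (l # p) * ari_mult b q)
            (vword (rev (l # p)) * g (?N (k # a) b (l # p) q) * vword q) =
          scale ((- 1) ^ length a * ari_mult a p * ari_mult b q)
          (scale (- ari k l) (vword (rev p) * (letter l * g (?N a b p q + (k - l))) * vword q))"
          by (simp add: ari_mult_Cons vword_append) (simp add: ac_simps)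
      qed
      also have "\<dots> = (\<Sum>p\<in>below a. \<Sum>l\<le>k. \<Sum>q\<in>below b.
        scale ((- 1) ^ length a * ari_mult a p * ari_mult b q)
          (scale (- ari k l) (vword (rev p) * (letter l * g (?N a b p q + (k - l))) * vword q)))"
        by (rule sum.swap)
      also have "\<dots> = (\<Sum>p\<in>below a. \<Sum>q\<in>below b. \<Sum>l\<le>k.
        scale ((- 1) ^ length a * ari_mult a p * ari_mult b q)
          (scale (- ari k l) (vword (rev p) * (letter l * g (?N a b p q + (k - l))) * vword q)))"
        by (rule sum.cong[OF refl], rule sum.swap)
      finally show ?thesis .
    qed
    have right: "?F a (k # b) = (\<Sum>p\<in>below a. \<Sum>q\<in>below b. \<Sum>l\<le>k.
        scale ((- 1) ^ length a * ari_mult a p * ari_mult b q)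
          (scale (ari k l) (vword (rev p) * (g (?N a b p q + (k - l)) * letter l) * vword q)))"
    proof (rule sum.cong[OF refl])
      fix p
      have "(\<Sum>q\<in>below (k # b). scale ((- 1) ^ length a * ari_mult a p * ari_mult (k # b) q)
           (vword (rev p) * g (?N a (k # b) p q) * vword q)) = (\<Sum>l\<le>k. \<Sum>q\<in>below b.
          scale ((- 1) ^ length a * ari_mult a p * ari_mult (k # b) (l # q))
            (vword (rev p) * g (?N a (k # b) p (l # q)) * vword (l # q)))"
        using sum_below_append[of _ "[k]" b] by (simp only: sum_below_singleton append.simps)
      also have "\<dots> = (\<Sum>l\<le>k. \<Sum>q\<in>below b.
        scale ((- 1) ^ length a * ari_mult a p * ari_mult b q)
          (scale (ari k l) (vword (rev p) * (g (?N a b p q + (k - l)) * letter l) * vword q)))"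
      proof (intro sum.cong refl)
        fix l q assume "l \<in> {..k}" "q \<in> below b"
        then have "?N a (k # b) p (l # q) = ?N a b p q + (k - l)"
          using below_sum_list_le[of q b] by simp
        then show "scale ((- 1) ^ length a * ari_mult a p * ari_mult (k # b) (l # q))
            (vword (rev p) * g (?N a (k # b) p (l # q)) * vword (l # q)) =
          scale ((- 1) ^ length a * ari_mult a p * ari_mult b q)
          (scale (ari k l) (vword (rev p) * (g (?N a b p q + (k - l)) * letter l) * vword q))"
          by (simp only: ari_mult_Cons vword_Cons[of l q]) (simp add: ac_simps)
      qed
      also have "\<dots> = (\<Sum>q\<in>below b. \<Sum>l\<le>k.
        scale ((- 1) ^ length a * ari_mult a p * ari_mult b q)
          (scale (ari k l) (vword (rev p) * (g (?N a b p q + (k - l)) * letter l) * vword q)))"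
        by (rule sum.swap)
      finally show "(\<Sum>q\<in>below (k # b). scale ((- 1) ^ length a * ari_mult a p * ari_mult (k # b) q)
           (vword (rev p) * g (?N a (k # b) p q) * vword q)) = \<dots>" .
    qed
    have "x * step k g m * y = (\<Sum>l\<le>k. scale (ari k l) (x * (g (m + (k - l)) * letter l) * y)
        + scale (- ari k l) (x * (letter l * g (m + (k - l))) * y))" for x y m
      by (simp add: step_def comm_def sum_distrib_left sum_distrib_right scale_mult_left
          scale_mult_right algebra_simps scale_diff_right scale_minus_left)
    then show "(\<Sum>p\<in>below a. \<Sum>q\<in>below b. scale ((- 1) ^ length a * ari_mult a p * ari_mult b q)
         (vword (rev p) * step k g (?N a b p q) * vword q)) = ?F (k # a) b + ?F a (k # b)"
      unfolding left right by (simp only: sum.distrib scale_sum scale_add_right ac_simps)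
  qed
  also have "\<dots> = unshuffle_sum ?F (k # u)"
    by (simp only: unshuffle_sum.simps unshuffle_sum_add)
  finally show ?case .
qed

section \<open>Shift tuples of a single block\<close>

lemma finite_below: "finite (below u)"
proof (rule finite_subset)
  show "below u \<subseteq> {ls. set ls \<subseteq> {..sum_list u} \<and> length ls = length u}"
    using below_sum_list_le[of _ u] member_le_sum_list
    by (fastforce simp: list_all2_lengthD intro: order_trans)
  show "finite {ls. set ls \<subseteq> {..sum_list u} \<and> length ls = length u}"
    by (rule finite_lists_length_eq) simp
qed

text \<open>The bound keeps the letter with index m - |l| in the right tensor factor positive. The
  empty tuple is exempt: v_0 occurs there only when the whole block is v_0.\<close>

definition shift_tuples :: "nat \<Rightarrow> nat \<Rightarrow> nat list set" where
  "shift_tuples n m = {l. length l = n \<and> (l = [] \<or> int (sum_list l) \<le> int m - 1)}"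

lemma finite_shift_tuples: "finite (shift_tuples n m)"
proof (rule finite_subset)
  show "shift_tuples n m \<subseteq> {l. set l \<subseteq> {..m} \<and> length l = n}"
  proof
    fix l assume l: "l \<in> shift_tuples n m"
    have "x \<le> m" if "x \<in> set l" for x
      using that l member_le_sum_list[OF that] by (auto simp: shift_tuples_def)
    with l show "l \<in> {l. set l \<subseteq> {..m} \<and> length l = n}"
      by (auto simp: shift_tuples_def)
  qed
  show "finite {l. set l \<subseteq> {..m} \<and> length l = n}"
    by (rule finite_lists_length_eq) simp
qed

lemma map2_add:
  assumes "length l = length k"
  shows "list_all2 (\<le>) k (map2 (+) k l)" "map2 (-) (map2 (+) k l) k = l"
    "sum_list (map2 (+) k l) = sum_list k + sum_list (l :: nat list)"
  using assms by (induction l k rule: list_induct2) simp_all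

lemma map2_diff:
  assumes "list_all2 (\<le>) k a"
  shows "map2 (+) k (map2 (-) a k) = a" "sum_list k + sum_list (map2 (-) a k) = sum_list (a :: nat list)"
    "length k = length a"
  using assms by (induction k a rule: list_all2_induct) simp_all

lemma cf_antipode_vword:
  "cf (antipode (vword w)) a = (if rev w = a then (- 1) ^ length a else 0)"
  by (auto simp: antipode_def lin_ext_vword lookup_scale cf_vword)

text \<open>The action lowers the letters of A, while the coproduct formula raises those of the
  block; these are the same shifts read in opposite directions. Each side has at most one nonzero
  term: p must be \<open>rev k1\<close> and q must be \<open>k2\<close>, while on the right a and b
  determine the shifts \<open>l0\<close>, a being reversed by the antipode. \<open>C\<close> says
  when the terms occur, \<open>V\<close> is their common value.\<close>

lemma shift_tuples_correspondence:
  fixes a b k1 k2 :: "nat list"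
  assumes "s > 0"
  shows "(\<Sum>p\<in>below a. \<Sum>q\<in>below b. (- 1) ^ length a * ari_mult a p * ari_mult b q *
      (if rev p = k1 \<and> s + (sum_list a - sum_list p) + (sum_list b - sum_list q) = m \<and> q = k2
       then 1 else 0)) =
    (\<Sum>l\<in>shift_tuples (length k1 + length k2) m. ari_mult (map2 (+) (k1 @ k2) l) (k1 @ k2) *
      (if m - sum_list l = s then 1 else 0) *
      (cf (antipode (vword (map2 (+) k1 (take (length k1) l)))) a *
       cf (vword (map2 (+) k2 (drop (length k1) l))) b))"
    (is "?L = ?R")
proof -
  define C where "C \<longleftrightarrow> rev k1 \<in> below a \<and> k2 \<in> below b \<and>
    s + (sum_list a - sum_list k1) + (sum_list b - sum_list k2) = m"
  define V where "V = (- 1) ^ length a * ari_mult a (rev k1) * ari_mult b k2"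
  define l0 where "l0 = map2 (-) (rev a) k1 @ map2 (-) b k2"
  define W where
    "W = (if s + (sum_list a - sum_list k1) + (sum_list b - sum_list k2) = m then V else 0)"
  have "?L = (\<Sum>p\<in>below a. \<Sum>q\<in>below b. if q = k2 then if p = rev k1 then W else 0 else 0)"
    by (intro sum.cong refl) (auto simp: V_def W_def)
  also have "\<dots> = (\<Sum>p\<in>below a. if p = rev k1 then if k2 \<in> below b then W else 0 else 0)"
    by (intro sum.cong refl) (simp only: sum.delta finite_below split: if_split, simp)
  also have "\<dots> = (if C then V else 0)"
    by (simp only: sum.delta finite_below) (simp add: C_def W_def)
  finally have L: "?L = (if C then V else 0)" .
  have C_iff: "rev (map2 (+) k1 (take (length k1) l)) = a \<and> map2 (+) k2 (drop (length k1) l) = b \<and>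
      m - sum_list l = s \<longleftrightarrow> C \<and> l = l0"
    if l: "l \<in> shift_tuples (length k1 + length k2) m" for l
  proof
    assume *: "rev (map2 (+) k1 (take (length k1) l)) = a \<and> map2 (+) k2 (drop (length k1) l) = b \<and>
      m - sum_list l = s"
    have len: "length (take (length k1) l) = length k1" "length (drop (length k1) l) = length k2"
      using l by (auto simp: shift_tuples_def)
    have a: "rev a = map2 (+) k1 (take (length k1) l)" and b: "b = map2 (+) k2 (drop (length k1) l)"
      using * by auto
    have "sum_list a = sum_list (rev a)" by simp
    then have sums: "sum_list a = sum_list k1 + sum_list (take (length k1) l)"
      "sum_list b = sum_list k2 + sum_list (drop (length k1) l)"
      using map2_add(3)[OF len(1)] map2_add(3)[OF len(2)] a b by auto
    have "sum_list l = sum_list (take (length k1) l) + sum_list (drop (length k1) l)"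
      by (metis append_take_drop_id sum_list_append)
    moreover have "m - sum_list l = s" using * by blast
    \<comment> \<open>As s is positive, the truncated subtraction giving s is exact.\<close>
    ultimately have "s + (sum_list a - sum_list k1) + (sum_list b - sum_list k2) = m"
      using sums assms by linarith
    moreover have "list_all2 (\<le>) (rev k1) a"
      using map2_add(1)[OF len(1)] a by (metis list_all2_rev rev_rev_ident)
    moreover have "list_all2 (\<le>) k2 b"
      using map2_add(1)[OF len(2)] b by simp
    moreover have "l = l0"
      using map2_add(2)[OF len(1)] map2_add(2)[OF len(2)] a b by (simp add: l0_def)
    ultimately show "C \<and> l = l0" by (simp add: C_def)
  next
    assume *: "C \<and> l = l0"
    then have le: "list_all2 (\<le>) k1 (rev a)" "list_all2 (\<le>) k2 b"
      by (auto simp: C_def) (metis list_all2_rev rev_rev_ident)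
    have "sum_list (rev a) = sum_list a" by simp
    then show "rev (map2 (+) k1 (take (length k1) l)) = a \<and> map2 (+) k2 (drop (length k1) l) = b \<and>
      m - sum_list l = s"
      using * map2_diff[OF le(1)] map2_diff[OF le(2)] by (auto simp: l0_def C_def)
  qed
  have l0: "l0 \<in> shift_tuples (length k1 + length k2) m" if C
  proof -
    have le: "list_all2 (\<le>) k1 (rev a)" "list_all2 (\<le>) k2 b"
      using that by (auto simp: C_def) (metis list_all2_rev rev_rev_ident)
    have "sum_list (rev a) = sum_list a" by simp
    then show ?thesis
      using that map2_diff[OF le(1)] map2_diff[OF le(2)] assms
      by (auto simp: shift_tuples_def C_def l0_def)
  qed
  have "?R = (\<Sum>l\<in>shift_tuples (length k1 + length k2) m. if C \<and> l = l0 then V else 0)"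
  proof (rule sum.cong[OF refl])
    fix l assume l: "l \<in> shift_tuples (length k1 + length k2) m"
    let ?k = "map2 (+) k1 (take (length k1) l)" and ?k' = "map2 (+) k2 (drop (length k1) l)"
    have split: "map2 (+) (k1 @ k2) l = ?k @ ?k'"
      by (simp add: zip_append1)
    have "ari_mult (?k @ ?k') (k1 @ k2) = ari_mult a (rev k1) * ari_mult b k2"
      if "rev ?k = a" "?k' = b"
      using l that(2) by (simp add: shift_tuples_def ari_mult_append ari_mult_rev flip: that(1))
    then have "ari_mult (map2 (+) (k1 @ k2) l) (k1 @ k2) *
      (if m - sum_list l = s then 1 else 0) *
      (cf (antipode (vword ?k)) a * cf (vword ?k') b) =
      (if rev ?k = a \<and> ?k' = b \<and> m - sum_list l = s then V else 0)"
      unfolding split cf_antipode_vword cf_vword V_def by auto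
    then show "ari_mult (map2 (+) (k1 @ k2) l) (k1 @ k2) *
      (if m - sum_list l = s then 1 else 0) *
      (cf (antipode (vword ?k)) a * cf (vword ?k') b) = (if C \<and> l = l0 then V else 0)"
      unfolding C_iff[OF l] .
  qed
  also have "\<dots> = (if C then V else 0)"
    using l0 by (cases C) (simp_all add: finite_shift_tuples)
  finally show ?thesis using L by simp
qed

text \<open>Only \<open>j = length x\<close> can contribute; a sum over all positions is used
  because its range does not depend on x and can be moved outside the sums over words.\<close>

lemma cf_word_letter_word:
  "cf (vword x * letter m * vword y) w =
    (\<Sum>j<length w. if x = take j w \<and> m = w ! j \<and> y = drop (Suc j) w then 1 else 0)"
proof -
  have "(\<Sum>j<length w. if x = take j w \<and> m = w ! j \<and> y = drop (Suc j) w then 1 else 0) =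
      (\<Sum>j<length w. if j = length x then (if x @ m # y = w then 1 else 0) else (0 :: rat))"
  proof (rule sum.cong[OF refl])
    fix j assume "j \<in> {..<length w}"
    then have j: "j < length w" by simp
    have "x = take j w \<and> m = w ! j \<and> y = drop (Suc j) w \<longleftrightarrow> j = length x \<and> x @ m # y = w"
      using j by (auto simp: id_take_nth_drop[symmetric])
    then show "(if x = take j w \<and> m = w ! j \<and> y = drop (Suc j) w then 1 else 0) =
        (if j = length x then (if x @ m # y = w then 1 else 0) else (0 :: rat))"
      by simp
  qed
  then show ?thesis
    by (auto simp: cf_vword simp flip: vword_append)
qed

definition block_coeff :: "nat list \<Rightarrow> nat \<Rightarrow> nat \<Rightarrow> nat list \<Rightarrow> rat" where
  "block_coeff w s j l =
     ari_mult (map2 (+) (take j w @ drop (Suc j) w) l) (take j w @ drop (Suc j) w) *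
     (if w ! j - sum_list l = s then 1 else 0)"

lemma cf_tri_letter:
  "cf (tri_letter u s) w =
    (\<Sum>j<length w. \<Sum>l\<in>shift_tuples (length w - 1) (w ! j). block_coeff w s j l *
      cf (shuffle (antipode (vword (map2 (+) (take j w) (take j l))))
        (vword (map2 (+) (drop (Suc j) w) (drop j l)))) u)"
proof (cases "s = 0")
  case True
  show ?thesis
  \<comment> \<open>Only the empty word acts nontrivially on v_0. On the right side a longer w has
    nonempty l, whose bound makes \<open>w ! j - sum_list l\<close> positive, so it cannot be
    0.\<close>
  proof (cases "length w = 1")
    case len: True
    then obtain m where w: "w = [m]" by (auto simp: length_Suc_conv)
    have "shift_tuples 0 m = {[]}" by (auto simp: shift_tuples_def)
    moreover have "antipode 1 = 1"
      using lin_ext_vword[of antipode_word "[]"] by (simp add: vword_Nil antipode_def)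
    ultimately show ?thesis
      using True w by (auto simp: block_coeff_def vword_Nil cf_one cf_vword)
  next
    case False
    have "block_coeff w s j l = 0" if "j < length w" "l \<in> shift_tuples (length w - 1) (w ! j)" for j l
    proof -
      have "l \<noteq> []" using that False by (auto simp: shift_tuples_def)
      with that True show ?thesis by (auto simp: shift_tuples_def block_coeff_def)
    qed
    moreover have "cf (tri_letter u s) w = 0"
      using False True by (auto simp: cf_vword)
    ultimately show ?thesis by simp
  qed
next
  case False
  then have s: "s > 0" by simp
  have "cf (tri_letter u s) w = unshuffle_sum (\<lambda>a b. \<Sum>p\<in>below a. \<Sum>q\<in>below b.
      (- 1) ^ length a * ari_mult a p * ari_mult b q *
      cf (vword (rev p) * letter (s + (sum_list a - sum_list p) + (sum_list b - sum_list q)) * vword q) w) u"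
    using False
    by (simp add: act_expansion unshuffle_sum_hom[of "\<lambda>x. Poly_Mapping.lookup x _", OF lookup_add]
        lookup_sum lookup_scale ac_simps)
  also have "\<dots> = unshuffle_sum (\<lambda>a b. \<Sum>p\<in>below a. \<Sum>q\<in>below b. \<Sum>j<length w.
      (- 1) ^ length a * ari_mult a p * ari_mult b q *
      (if rev p = take j w \<and> s + (sum_list a - sum_list p) + (sum_list b - sum_list q) = w ! j \<and>
        q = drop (Suc j) w then 1 else 0)) u"
    by (simp only: cf_word_letter_word sum_distrib_left)
  also have "\<dots> = unshuffle_sum (\<lambda>a b. \<Sum>j<length w. \<Sum>p\<in>below a. \<Sum>q\<in>below b.
      (- 1) ^ length a * ari_mult a p * ari_mult b q *
      (if rev p = take j w \<and> s + (sum_list a - sum_list p) + (sum_list b - sum_list q) = w ! j \<and>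
        q = drop (Suc j) w then 1 else 0)) u"
    by (subst sum.swap[of _ "below _" "{..<length w}"], subst sum.swap[of _ "{..<length w}"]) (rule refl)
  also have "\<dots> = unshuffle_sum (\<lambda>a b. \<Sum>j<length w. \<Sum>l\<in>shift_tuples (length w - 1) (w ! j).
      block_coeff w s j l * (cf (antipode (vword (map2 (+) (take j w) (take j l)))) a *
        cf (vword (map2 (+) (drop (Suc j) w) (drop j l))) b)) u"
  proof (rule unshuffle_sum_cong, rule sum.cong[OF refl])
    fix a b :: "nat list" and j assume "j \<in> {..<length w}"
    then have "length (take j w) = j" "length (take j w) + length (drop (Suc j) w) = length w - 1"
      by auto
    then show "(\<Sum>p\<in>below a. \<Sum>q\<in>below b. (- 1) ^ length a * ari_mult a p * ari_mult b q *
      (if rev p = take j w \<and> s + (sum_list a - sum_list p) + (sum_list b - sum_list q) = w ! j \<and>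
        q = drop (Suc j) w then 1 else 0)) = (\<Sum>l\<in>shift_tuples (length w - 1) (w ! j).
      block_coeff w s j l * (cf (antipode (vword (map2 (+) (take j w) (take j l)))) a *
        cf (vword (map2 (+) (drop (Suc j) w) (drop j l))) b))"
      unfolding shift_tuples_correspondence[OF s] by (simp only: block_coeff_def)
  qed
  also have "\<dots> = (\<Sum>j<length w. \<Sum>l\<in>shift_tuples (length w - 1) (w ! j). block_coeff w s j l *
      cf (shuffle (antipode (vword (map2 (+) (take j w) (take j l))))
        (vword (map2 (+) (drop (Suc j) w) (drop j l)))) u)"
    by (simp only: unshuffle_sum_sum cf_shuffle unshuffle_sum_hom[of "\<lambda>x. _ * x", OF distrib_left])
  finally show ?thesis .
qed

subsection \<open>Peeling off the last block\<close>

lemma cuts_0: "cuts d 0 = {([], [])}"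
  by (auto simp: cuts_def)

lemma cuts_snoc:
  "(I @ [i], J @ [j]) \<in> cuts d (Suc n) \<longleftrightarrow> i < j \<and> j \<le> d \<and> (I, J) \<in> cuts i n"
  by (auto simp: cuts_def All_less_Suc nth_append)

lemma cuts_Suc:
  "cuts d (Suc n) = (\<lambda>(i, j, I, J). (I @ [i], J @ [j])) `
     (SIGMA i:{..<d}. SIGMA j:{i<..d}. cuts i n)"
proof (intro set_eqI iffI)
  fix x assume x: "x \<in> cuts d (Suc n)"
  obtain I' J' where x': "x = (I', J')" by fastforce
  with x have "length I' = Suc n" "length J' = Suc n" by (auto simp: cuts_def)
  then obtain I i J j where IJ: "I' = I @ [i]" "J' = J @ [j]"
    by (metis length_Suc_conv_rev)
  with x x' have "i < j" "j \<le> d" "(I, J) \<in> cuts i n"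
    by (auto simp: cuts_snoc)
  then show "x \<in> (\<lambda>(i, j, I, J). (I @ [i], J @ [j])) `
     (SIGMA i:{..<d}. SIGMA j:{i<..d}. cuts i n)"
    unfolding x' IJ by (intro image_eqI[of _ _ "(i, j, I, J)"]) auto
qed (auto simp: cuts_snoc)

lemma finite_cuts: "finite (cuts d n)"
  by (induction n arbitrary: d) (auto simp: cuts_0 cuts_Suc)

lemma cuts_empty: "d < n \<Longrightarrow> cuts d n = {}"
  by (induction n arbitrary: d) (auto simp: cuts_Suc)

lemma sum_cuts_Suc:
  "(\<Sum>(I, J)\<in>cuts d (Suc n). F I J) =
    (\<Sum>i<d. \<Sum>j\<in>{i<..d}. \<Sum>(I, J)\<in>cuts i n. F (I @ [i]) (J @ [j]))"
proof -
  have "inj_on (\<lambda>(i, j, I, J). (I @ [i], J @ [j])) A" for A :: "(nat \<times> nat \<times> nat list \<times> nat list) set"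
    by (auto simp: inj_on_def)
  then show ?thesis
    unfolding cuts_Suc
    by (subst sum.reindex) (auto simp: sum.Sigma finite_cuts case_prod_beta' intro!: sum.cong)
qed

text \<open>The end d replaces the length of \<open>ks\<close>: removing the last block leaves a cut
  of a prefix, while all positions continue to refer to \<open>ks\<close>.\<close>

definition shifts_upto :: "nat list \<Rightarrow> nat \<Rightarrow> nat list \<Rightarrow> nat list \<Rightarrow> nat list list set" where
  "shifts_upto ks d I J = {ls. length ls = length I \<and>
     (\<forall>s<length I. ls ! s \<in> shift_tuples ((I @ [d]) ! Suc s - I ! s - 1) (ks ! (J ! s - 1)))}"

lemma shifts_eq: "shifts ks I J = shifts_upto ks (length ks) I J"
  by (auto simp: shifts_def shifts_upto_def shift_tuples_def)

lemma sum_shifts_snoc: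
  assumes "length I = length J"
  shows "(\<Sum>ls\<in>shifts_upto ks d (I @ [i]) (J @ [j]). F ls) =
    (\<Sum>ls\<in>shifts_upto ks i I J. \<Sum>l\<in>shift_tuples (d - i - 1) (ks ! (j - 1)). F (ls @ [l]))"
proof -
  have snoc: "ls @ [l] \<in> shifts_upto ks d (I @ [i]) (J @ [j]) \<longleftrightarrow>
      ls \<in> shifts_upto ks i I J \<and> l \<in> shift_tuples (d - i - 1) (ks ! (j - 1))" for ls l
    using assms by (auto simp: shifts_upto_def All_less_Suc nth_append)
  have nonempty: "ls \<noteq> []" if "ls \<in> shifts_upto ks d (I @ [i]) (J @ [j])" for ls
    using that by (auto simp: shifts_upto_def)
  have split: "butlast ls \<in> shifts_upto ks i I J \<and> last ls \<in> shift_tuples (d - i - 1) (ks ! (j - 1))"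
    if "ls \<in> shifts_upto ks d (I @ [i]) (J @ [j])" for ls
    using that nonempty[OF that] snoc[of "butlast ls" "last ls"] by simp
  show ?thesis
    unfolding sum.cartesian_product
    by (rule sum.reindex_bij_witness[of _ "\<lambda>(ls, l). ls @ [l]" "\<lambda>ls. (butlast ls, last ls)"])
      (use nonempty split snoc in auto)
qed

section \<open>Terms of the coproduct formula for a fixed right factor\<close>

definition multiplicity :: "nat list \<Rightarrow> nat \<Rightarrow> nat \<Rightarrow> nat \<Rightarrow> nat list \<Rightarrow> rat" where
  "multiplicity ks i j d l = ari_mult (map2 (+) (khat ks i j d) l) (khat ks i j d)"

text \<open>The left tensor factor of one summand of the formula, kept only if its right factor is
  the word \<open>ws\<close>.\<close>

definition cut_term ::
    "nat list \<Rightarrow> nat \<Rightarrow> nat list \<Rightarrow> nat list \<Rightarrow> nat list \<Rightarrow> nat list list \<Rightarrow> QV" where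
  "cut_term ks d ws I J ls =
     scale ((\<Prod>s<length ws. multiplicity ks (I ! s) (J ! s) ((I @ [d]) ! Suc s) (ls ! s)) *
         (if map (\<lambda>s. ks ! (J ! s - 1) - sum_list (ls ! s)) [0..<length ws] = ws then 1 else 0))
       (shuffle (vword (slice ks 0 ((I @ [d]) ! 0)))
          (foldr shuffle
            (map (\<lambda>s. block ks (I ! s) (J ! s) ((I @ [d]) ! Suc s) (ls ! s)) [0..<length ws]) 1))"

definition block_term :: "nat list \<Rightarrow> nat \<Rightarrow> nat \<Rightarrow> nat \<Rightarrow> nat \<Rightarrow> nat list \<Rightarrow> QV" where
  "block_term ks i j d w l =
     scale (multiplicity ks i j d l * (if ks ! (j - 1) - sum_list l = w then 1 else 0))
       (block ks i j d l)"

definition cut_sum :: "nat list \<Rightarrow> nat \<Rightarrow> nat list \<Rightarrow> QV" where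
  "cut_sum ks d ws =
     (\<Sum>(I, J)\<in>cuts d (length ws). \<Sum>ls\<in>shifts_upto ks d I J. cut_term ks d ws I J ls)"

lemma foldr_shuffle_snoc: "foldr shuffle (Xs @ [Y]) 1 = shuffle (foldr shuffle Xs 1) Y"
  by (induction Xs) (simp_all add: shuffle_assoc)

lemma cut_term_snoc:
  assumes "length I = length ws" "length J = length ws" "length ls = length ws"
  shows "cut_term ks d (ws @ [w]) (I @ [i]) (J @ [j]) (ls @ [l]) =
    shuffle (cut_term ks i ws I J ls) (block_term ks i j d w l)"
proof -
  let ?n = "length ws" and ?I = "I @ [i]" and ?J = "J @ [j]" and ?ls = "ls @ [l]"
  have nth: "?I ! s = I ! s" "?J ! s = J ! s" "?ls ! s = ls ! s" "(?I @ [d]) ! Suc s = ?I ! Suc s"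
    if "s < ?n" for s
    using that assms by (auto simp: nth_append)
  have last: "?I ! ?n = i" "?J ! ?n = j" "?ls ! ?n = l" "(?I @ [d]) ! Suc ?n = d"
    using assms by (auto simp: nth_append)
  have prod: "(\<Prod>s<length (ws @ [w]). multiplicity ks (?I ! s) (?J ! s) ((?I @ [d]) ! Suc s) (?ls ! s)) =
      (\<Prod>s<?n. multiplicity ks (I ! s) (J ! s) (?I ! Suc s) (ls ! s)) * multiplicity ks i j d l"
    using nth last by simp
  have letters: "map (\<lambda>s. ks ! (?J ! s - 1) - sum_list (?ls ! s)) [0..<length (ws @ [w])] =
      map (\<lambda>s. ks ! (J ! s - 1) - sum_list (ls ! s)) [0..<?n] @ [ks ! (j - 1) - sum_list l]"
    using nth last by simp
  have blocks: "map (\<lambda>s. block ks (?I ! s) (?J ! s) ((?I @ [d]) ! Suc s) (?ls ! s)) [0..<length (ws @ [w])] =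
      map (\<lambda>s. block ks (I ! s) (J ! s) (?I ! Suc s) (ls ! s)) [0..<?n] @ [block ks i j d l]"
    using nth last by simp
  have first: "(?I @ [d]) ! 0 = ?I ! 0" by (simp add: nth_append)
  show ?thesis
    unfolding cut_term_def block_term_def prod letters blocks first foldr_shuffle_snoc
    by (simp add: shuffle_linear shuffle_assoc mult.commute)
qed

lemma cut_sum_Nil: "cut_sum ks d [] = vword (slice ks 0 d)"
  by (simp add: cut_sum_def cuts_0 shifts_upto_def cut_term_def)

text \<open>Multiplicities multiply and the shuffle product is associative, so the last block splits
  off. The sum over its left end i will match a deconcatenation in
  \<open>gl_prod_snoc\<close>.\<close>

lemma cut_sum_snoc:
  "cut_sum ks d (ws @ [w]) = (\<Sum>i<d. shuffle (cut_sum ks i ws)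
     (\<Sum>j\<in>{i<..d}. \<Sum>l\<in>shift_tuples (d - i - 1) (ks ! (j - 1)). block_term ks i j d w l))"
proof -
  have "cut_sum ks d (ws @ [w]) = (\<Sum>i<d. \<Sum>j\<in>{i<..d}. \<Sum>(I, J)\<in>cuts i (length ws).
      \<Sum>ls\<in>shifts_upto ks d (I @ [i]) (J @ [j]). cut_term ks d (ws @ [w]) (I @ [i]) (J @ [j]) ls)"
    by (simp add: cut_sum_def sum_cuts_Suc)
  also have "\<dots> = (\<Sum>i<d. \<Sum>j\<in>{i<..d}. \<Sum>(I, J)\<in>cuts i (length ws). \<Sum>ls\<in>shifts_upto ks i I J.
      shuffle (cut_term ks i ws I J ls)
        (\<Sum>l\<in>shift_tuples (d - i - 1) (ks ! (j - 1)). block_term ks i j d w l))"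
  proof (intro sum.cong refl, clarify)
    fix i j I J assume IJ: "(I, J) \<in> cuts i (length ws)"
    then have len: "length I = length ws" "length J = length ws" by (auto simp: cuts_def)
    have "cut_term ks d (ws @ [w]) (I @ [i]) (J @ [j]) (ls @ [l]) =
        shuffle (cut_term ks i ws I J ls) (block_term ks i j d w l)"
      if "ls \<in> shifts_upto ks i I J" for ls l
      using that len by (intro cut_term_snoc) (auto simp: shifts_upto_def)
    then show "(\<Sum>ls\<in>shifts_upto ks d (I @ [i]) (J @ [j]). cut_term ks d (ws @ [w]) (I @ [i]) (J @ [j]) ls) =
      (\<Sum>ls\<in>shifts_upto ks i I J. shuffle (cut_term ks i ws I J ls)
        (\<Sum>l\<in>shift_tuples (d - i - 1) (ks ! (j - 1)). block_term ks i j d w l))"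
      using len by (simp add: sum_shifts_snoc lin_sum[OF lin_shuffle(2)[OF lin_id]])
  qed
  also have "\<dots> = (\<Sum>i<d. \<Sum>j\<in>{i<..d}. shuffle (cut_sum ks i ws)
      (\<Sum>l\<in>shift_tuples (d - i - 1) (ks ! (j - 1)). block_term ks i j d w l))"
    by (simp add: cut_sum_def case_prod_beta' lin_sum[OF lin_shuffle(1)[OF lin_id]])
  finally show ?thesis
    by (simp add: lin_sum[OF lin_shuffle(2)[OF lin_id]])
qed

lemma cf_block_sum:
  assumes "i < d" "d \<le> length ks"
  shows "cf (\<Sum>j\<in>{i<..d}. \<Sum>l\<in>shift_tuples (d - i - 1) (ks ! (j - 1)). block_term ks i j d w l) u =
    cf (tri_letter u w) (slice ks i d)"
proof -
  let ?v = "slice ks i d"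
  have len: "length ?v = d - i" using assms by (simp add: slice_def)
  have "cf (tri_letter u w) ?v =
    (\<Sum>j'<d - i. \<Sum>l\<in>shift_tuples (d - i - 1) (?v ! j'). block_coeff ?v w j' l *
      cf (shuffle (antipode (vword (map2 (+) (take j' ?v) (take j' l))))
        (vword (map2 (+) (drop (Suc j') ?v) (drop j' l)))) u)"
    unfolding cf_tri_letter len ..
  also have "\<dots> = (\<Sum>j\<in>{i<..d}. \<Sum>l\<in>shift_tuples (d - i - 1) (ks ! (j - 1)). cf (block_term ks i j d w l) u)"
  \<comment> \<open>The formula counts positions in \<open>ks\<close> from 1,
    \<open>cf_tri_letter\<close> counts positions in the block from 0; hence
    \<open>j = Suc (i + j')\<close>.\<close>
  proof (rule sum.reindex_bij_witness[of _ "\<lambda>j. j - i - 1" "\<lambda>j'. Suc (i + j')"])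
    fix j' assume "j' \<in> {..<d - i}"
    then have j': "j' < d - i" by simp
    have "take j' ?v = slice ks i (Suc (i + j') - 1)"
      using j' by (simp add: slice_def)
    moreover have "drop (Suc j') ?v = slice ks (Suc (i + j')) d"
      using j' by (simp add: slice_def drop_take add.commute)
    moreover have "?v ! j' = ks ! (Suc (i + j') - 1)"
      using j' assms by (simp add: slice_def)
    ultimately show "(\<Sum>l\<in>shift_tuples (d - i - 1) (ks ! (Suc (i + j') - 1)).
        cf (block_term ks i (Suc (i + j')) d w l) u) =
      (\<Sum>l\<in>shift_tuples (d - i - 1) (?v ! j'). block_coeff ?v w j' l *
      cf (shuffle (antipode (vword (map2 (+) (take j' ?v) (take j' l))))
        (vword (map2 (+) (drop (Suc j') ?v) (drop j' l)))) u)"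
      by (simp only: block_coeff_def block_term_def multiplicity_def khat_def block_def lookup_scale)
        simp
  qed auto
  finally show ?thesis by (simp add: lookup_sum)
qed

subsection \<open>The Grossman-Larson product and its dual\<close>

lemma gl_prod_eq: "gl_prod A B = sweedler (\<lambda>a b. a * tri b B) A"
  by (simp add: gl_prod_def tri_a_eq)

lemma gl_prod_Nil: "gl_prod (vword u) 1 = vword u"
proof -
  have "gl_prod (vword u) 1 = unshuffle_sum (\<lambda>p q. if q = [] then vword p else 0) u"
    unfolding gl_prod_eq sweedler_vword
    by (rule unshuffle_sum_cong) (simp add: tri_one_right cf_vword)
  then show ?thesis by (simp only: unshuffle_sum_Nil_right)
qed

text \<open>A acts on \<open>ws\<close> and on w through different tensor factors of its coproduct.
  By coassociativity the first two of the three parts of A form a Grossman-Larson product with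
  \<open>ws\<close> again.\<close>

lemma gl_prod_snoc:
  "gl_prod (vword u) (vword (ws @ [w])) =
    unshuffle_sum (\<lambda>p q. gl_prod (vword p) (vword ws) * tri_letter q w) u"
proof -
  have "gl_prod (vword u) (vword (ws @ [w])) = unshuffle_sum (\<lambda>p q. unshuffle_sum (\<lambda>r s.
      vword p * tri (vword r) (vword ws) * tri_letter s w) q) u"
    by (simp add: gl_prod_eq sweedler_vword vword_append tri_mult tri_vword_letter mult.assoc
        unshuffle_sum_hom[of "\<lambda>x. _ * x", OF distrib_left] del: tri_letter.simps)
  also have "\<dots> = unshuffle_sum (\<lambda>p q. unshuffle_sum (\<lambda>r s.
      vword r * tri (vword s) (vword ws) * tri_letter q w) p) u"
    by (rule unshuffle_sum_assoc[symmetric])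
  finally show ?thesis
    by (simp add: gl_prod_eq sweedler_vword unshuffle_sum_hom[of "\<lambda>x. x * _", OF distrib_right]
        del: tri_letter.simps)
qed

text \<open>Both sides obey one recursion in the last letter of \<open>ws\<close>: shuffling on the
  left is dual to splitting u, and cutting at i is deconcatenation on the right. The induction needs
  every prefix length d.\<close>

lemma cf_cut_sum:
  "d \<le> length ks \<Longrightarrow> cf (cut_sum ks d ws) u = cf (gl_prod (vword u) (vword ws)) (take d ks)"
proof (induction ws arbitrary: d u rule: rev_induct)
  case Nil
  show ?case
    by (auto simp: cut_sum_Nil vword_Nil gl_prod_Nil cf_vword slice_def)
next
  case (snoc w ws)
  let ?G = "\<lambda>p. gl_prod (vword p) (vword ws)"
  have "cf (gl_prod (vword u) (vword (ws @ [w]))) (take d ks) =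
      unshuffle_sum (\<lambda>p q. \<Sum>i\<le>d. cf (?G p) (take i ks) * cf (tri_letter q w) (slice ks i d)) u"
    using snoc.prems
    by (simp add: gl_prod_snoc unshuffle_sum_hom[of "\<lambda>x. Poly_Mapping.lookup x _", OF lookup_add]
        cf_mult slice_def drop_take min_def del: tri_letter.simps)
  \<comment> \<open>The term i = d would have an empty last block and vanishes by
    \<open>cf_tri_letter_Nil\<close>.\<close>
  also have "\<dots> = unshuffle_sum (\<lambda>p q. \<Sum>i<d. cf (?G p) (take i ks) * cf (tri_letter q w) (slice ks i d)) u"
    using cf_tri_letter_Nil[of "vword _" w]
    by (simp add: slice_def tri_vword_letter lessThan_Suc_atMost[symmetric] del: tri_letter.simps)
  also have "\<dots> = (\<Sum>i<d. unshuffle_sum (\<lambda>p q. cf (?G p) (take i ks) * cf (tri_letter q w) (slice ks i d)) u)"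
    by (rule unshuffle_sum_sum)
  also have "\<dots> = cf (cut_sum ks d (ws @ [w])) u"
    unfolding cut_sum_snoc lookup_sum[of _ "{..<d}"] cf_shuffle
  proof (rule sum.cong[OF refl], rule unshuffle_sum_cong)
    fix i p q assume "i \<in> {..<d}"
    then have "i < d" "i \<le> length ks" using snoc.prems by auto
    then show "cf (?G p) (take i ks) * cf (tri_letter q w) (slice ks i d) = cf (cut_sum ks i ws) p *
        cf (\<Sum>j\<in>{i<..d}. \<Sum>l\<in>shift_tuples (d - i - 1) (ks ! (j - 1)). block_term ks i j d w l) q"
      by (simp only: snoc.IH cf_block_sum snoc.prems)
  qed
  finally show ?case ..
qed

lemma lin_tensor: "lin f \<Longrightarrow> lin (\<lambda>p. tensor (f p) y)" "lin f \<Longrightarrow> lin (\<lambda>p. tensor y (f p))"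
  unfolding tensor_def by (auto intro!: lin_bilin_ext_left lin_bilin_ext_right)

lemma lin_gl_prod: "lin (\<lambda>p. gl_prod p y)" "lin (\<lambda>p. gl_prod y p)"
  unfolding gl_prod_eq by (auto intro!: lin_sweedler lin_sweedler_fun lin_mult_right lin_tri)

lemma tensor_vword: "tensor (vword u) (vword w) = Poly_Mapping.single (Word u, Word w) 1"
  by (simp add: tensor_def bilin_ext_vword)

lemma lookup_tensor_vword:
  "Poly_Mapping.lookup (tensor X (vword w)) (Word u, Word ws) = cf X u * (if w = ws then 1 else 0)"
  by (induction X rule: word_induct)
    (auto simp: tensor_vword lookup_single when_def cf_vword lookup_add lookup_scale
      lin_add[OF lin_tensor(1)[OF lin_id]] lin_scale[OF lin_tensor(1)[OF lin_id]])

lemma Delta_a_eqI: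
  assumes "\<And>u w. cf (gl_prod (vword u) (vword w)) ks = Poly_Mapping.lookup D (Word u, Word w)"
  shows "Delta_a (vword ks) = D"
  unfolding Delta_a_def
proof (rule the_equality)
  show "\<forall>A B. pairing (gl_prod A B) (vword ks) = pairing (tensor A B) D"
  proof (intro allI)
    fix A B
    show "pairing (gl_prod A B) (vword ks) = pairing (tensor A B) D"
    proof (induction A rule: word_induct)
      case (vword u)
      show ?case
      proof (induction B rule: word_induct)
        case (vword w)
        show ?case
          using assms[of u w]
          by (simp add: tensor_vword pairing_single_left) (simp add: vword_def pairing_single_right)
      qed (simp_all add: lin_add[OF lin_gl_prod(2)] lin_scale[OF lin_gl_prod(2)]
          lin_add[OF lin_tensor(2)[OF lin_id]] lin_scale[OF lin_tensor(2)[OF lin_id]]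
          pairing_add_left pairing_scale_left)
    qed (simp_all add: lin_add[OF lin_gl_prod(1)] lin_scale[OF lin_gl_prod(1)]
          lin_add[OF lin_tensor(1)[OF lin_id]] lin_scale[OF lin_tensor(1)[OF lin_id]]
          pairing_add_left pairing_scale_left)
  qed
next
  fix D' assume D': "\<forall>A B. pairing (gl_prod A B) (vword ks) = pairing (tensor A B) D'"
  show "D' = D"
  proof (rule poly_mapping_eqI)
    fix k
    obtain u w where k: "k = (Word u, Word w)" by (metis surj_pair word.exhaust)
    have "pairing (gl_prod (vword u) (vword w)) (vword ks) = Poly_Mapping.lookup D' k"
      using D' by (simp add: tensor_vword pairing_single_left k)
    then show "Poly_Mapping.lookup D' k = Poly_Mapping.lookup D k"
      using assms[of u w] by (simp add: k vword_def[of ks] pairing_single_right)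
  qed
qed

theorem theorem4p25:
  fixes ks :: "nat list"
  shows "Delta_a (vword ks) =
    (\<Sum>n\<le>length ks. \<Sum>(I, J)\<in>cuts (length ks) n. \<Sum>ls\<in>shifts ks I J.
       scale
         (\<Prod>s<n. ari_mult
            (map2 (+) (khat ks (I ! s) (J ! s) ((I @ [length ks]) ! Suc s)) (ls ! s))
            (khat ks (I ! s) (J ! s) ((I @ [length ks]) ! Suc s)))
         (tensor
            (shuffle
               (vword (slice ks 0 ((I @ [length ks]) ! 0)))
               (foldr shuffle
                  (map (\<lambda>s. block ks (I ! s) (J ! s) ((I @ [length ks]) ! Suc s) (ls ! s)) [0..<n]) 1))
            (vword (map (\<lambda>s. ks ! (J ! s - 1) - sum_list (ls ! s)) [0..<n]))))"
    (is "_ = (\<Sum>n\<le>_. ?D n)")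
proof (rule Delta_a_eqI)
  fix u ws
  have same: "Poly_Mapping.lookup (?D (length ws)) (Word u, Word ws) = cf (cut_sum ks (length ks) ws) u"
    by (simp add: cut_sum_def cut_term_def lookup_sum lookup_scale lookup_tensor_vword
        case_prod_beta' shifts_eq multiplicity_def ac_simps)
  have "Poly_Mapping.lookup (?D n) (Word u, Word ws) = 0" if "n \<noteq> length ws" for n
  proof -
    have "map f [0..<n] \<noteq> ws" for f :: "nat \<Rightarrow> nat" using that by auto
    then show ?thesis
      by (simp add: lookup_sum lookup_scale lookup_tensor_vword case_prod_beta')
  qed
  then have "Poly_Mapping.lookup (\<Sum>n\<le>length ks. ?D n) (Word u, Word ws) =
      (\<Sum>n\<le>length ks. if n = length ws then cf (cut_sum ks (length ks) ws) u else 0)"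
    unfolding lookup_sum[of _ "{..length ks}"] using same by (intro sum.cong) auto
  \<comment> \<open>If \<open>ws\<close> is longer than \<open>ks\<close>, no n in the range equals
    its length; by \<open>cuts_empty\<close> the right side is then 0 as well.\<close>
  also have "\<dots> = cf (cut_sum ks (length ks) ws) u"
    by (auto simp: cut_sum_def cuts_empty)
  also have "\<dots> = cf (gl_prod (vword u) (vword ws)) ks"
    by (simp add: cf_cut_sum)
  finally show "cf (gl_prod (vword u) (vword ws)) ks =
      Poly_Mapping.lookup (\<Sum>n\<le>length ks. ?D n) (Word u, Word ws)" ..
qed

end
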